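(* There exists no non-trivially Hoffman colorable exceptional graph $G$ with $\lambda_{\min}(G)>-2$.
   Context: Graphs are finite and simple; $\lambda_{\max},\lambda_{\min}$ are the largest/smallest adjacency eigenvalues. A graph $G$ with an edge is Hoffman colorable if $\chi(G)=1-\lambda_{\max}(G)/\lambda_{\min}(G)$, and non-trivially Hoffman colorable if moreover it is not bipartite and not a complete multipartite graph $K_{m,\dots,m}$ with equal part sizes. Generalized line graphs: for a graph $G$ on $v_1,\dots,v_n$ and nonnegative integers $a_i$, $L(G;a_1,\dots,a_n)$ is the disjoint union of the line graph $L(G)$ and cocktail party graphs $CP(a_i)$ (complete multipartite with $a_i$ parts of size 2), with every vertex of the $i$-th cocktail party graph joined to every edge of $G$ incident with $v_i$. The $E_8$ root system is the set of vectors in $\mathbb Z^8$ with two coordinates $\pm2$ and others $0$, or all coordinates $\pm1$ with an even number of $-1$'s. A graph is exceptional if it is connected, not a generalized line graph, and admits an injective map $f:V(G)\to E_8$ with $\langle f(u),f(v)\rangle=4$ for adjacent and $0$ for distinct non-adjacent $u,v$. *)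

theory Defs
  imports
    "Graph_Theory.Pair_Digraph"
    "Graph_Theory.Digraph_Isomorphism"
    "Jordan_Normal_Form.Char_Poly"
begin

text \<open>
  A finite simple graph is a \<open>G :: 'a pair_pre_digraph\<close> with \<open>pair_graph G\<close>: a finite
  vertex set \<open>pverts G\<close> and an irreflexive, symmetric adjacency relation \<open>parcs G\<close> on it.
\<close>

text \<open>\<open>vs\<close> is an enumeration of the vertices; it fixes the order of rows and columns.\<close>

definition adj_mat :: "'a pair_pre_digraph \<Rightarrow> 'a list \<Rightarrow> real mat" where
  "adj_mat G vs = mat (length vs) (length vs)
     (\<lambda>(i, j). if (vs ! i, vs ! j) \<in> parcs G then 1 else 0)"

definition adj_eigenvalues :: "'a pair_pre_digraph \<Rightarrow> real set" where
  "adj_eigenvalues G =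
     {k. \<exists>vs. distinct vs \<and> set vs = pverts G \<and> eigenvalue (adj_mat G vs) k}"

definition lambda_max :: "'a pair_pre_digraph \<Rightarrow> real" where
  "lambda_max G = Max (adj_eigenvalues G)"

definition lambda_min :: "'a pair_pre_digraph \<Rightarrow> real" where
  "lambda_min G = Min (adj_eigenvalues G)"

definition proper_coloring :: "'a pair_pre_digraph \<Rightarrow> nat \<Rightarrow> ('a \<Rightarrow> nat) \<Rightarrow> bool" where
  "proper_coloring G k c \<longleftrightarrow>
     (\<forall>v \<in> pverts G. c v < k) \<and> (\<forall>(u, v) \<in> parcs G. c u \<noteq> c v)"

definition chromatic_number :: "'a pair_pre_digraph \<Rightarrow> nat" where
  "chromatic_number G = (LEAST k. \<exists>c. proper_coloring G k c)"

definition hoffman_colorable :: "'a pair_pre_digraph \<Rightarrow> bool" where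
  "hoffman_colorable G \<longleftrightarrow>
     parcs G \<noteq> {} \<and> real (chromatic_number G) = 1 - lambda_max G / lambda_min G"

definition bipartite :: "'a pair_pre_digraph \<Rightarrow> bool" where
  "bipartite G \<longleftrightarrow>
     (\<exists>U W. pverts G = U \<union> W \<and> U \<inter> W = {} \<and> parcs G \<subseteq> U \<times> W \<union> W \<times> U)"

definition balanced_complete_multipartite :: "'a pair_pre_digraph \<Rightarrow> bool" where
  "balanced_complete_multipartite G \<longleftrightarrow>
     (\<exists>m P. partition_on (pverts G) P \<and> (\<forall>p \<in> P. card p = m) \<and>
        (\<forall>u \<in> pverts G. \<forall>v \<in> pverts G.
           (u, v) \<in> parcs G \<longleftrightarrow> \<not> (\<exists>p \<in> P. u \<in> p \<and> v \<in> p)))"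

definition nontrivially_hoffman_colorable :: "'a pair_pre_digraph \<Rightarrow> bool" where
  "nontrivially_hoffman_colorable G \<longleftrightarrow>
     hoffman_colorable G \<and> \<not> bipartite G \<and> \<not> balanced_complete_multipartite G"

definition edge_set :: "'a pair_pre_digraph \<Rightarrow> 'a set set" where
  "edge_set G = {{u, v} | u v. (u, v) \<in> parcs G}"

definition line_graph :: "'a pair_pre_digraph \<Rightarrow> 'a set pair_pre_digraph" where
  "line_graph G = \<lparr> pverts = edge_set G,
     parcs = {(e, f). e \<in> edge_set G \<and> f \<in> edge_set G \<and> e \<noteq> f \<and> e \<inter> f \<noteq> {}} \<rparr>"

text \<open>The \<open>i\<close>-th part of the cocktail party graph is \<open>{(i, False), (i, True)}\<close>.\<close>

definition cocktail_party :: "nat \<Rightarrow> (nat \<times> bool) pair_pre_digraph" where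
  "cocktail_party n = \<lparr> pverts = {..<n} \<times> UNIV,
     parcs = {((i, b), (j, c)) | i b j c. i < n \<and> j < n \<and> i \<noteq> j} \<rparr>"

text \<open>\<open>Inr (v, p)\<close> is the vertex \<open>p\<close> of the cocktail party graph belonging to \<open>v\<close>.\<close>

definition generalized_line_graph ::
  "'a pair_pre_digraph \<Rightarrow> ('a \<Rightarrow> nat) \<Rightarrow> ('a set + 'a \<times> nat \<times> bool) pair_pre_digraph" where
  "generalized_line_graph G a = \<lparr>
     pverts = Inl ` pverts (line_graph G) \<union>
       {Inr (v, p) | v p. v \<in> pverts G \<and> p \<in> pverts (cocktail_party (a v))},
     parcs = {(Inl e, Inl f) | e f. (e, f) \<in> parcs (line_graph G)} \<union>
       {(Inr (v, p), Inr (v, q)) | v p q.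
          v \<in> pverts G \<and> (p, q) \<in> parcs (cocktail_party (a v))} \<union>
       {(Inl e, Inr (v, p)) | e v p.
          e \<in> edge_set G \<and> v \<in> e \<and> p \<in> pverts (cocktail_party (a v))} \<union>
       {(Inr (v, p), Inl e) | e v p.
          e \<in> edge_set G \<and> v \<in> e \<and> p \<in> pverts (cocktail_party (a v))} \<rparr>"

text \<open>
  The underlying graph \<open>H\<close> may be taken on natural numbers, since every finite graph is
  isomorphic to such a graph.
\<close>

definition is_generalized_line_graph :: "'a pair_pre_digraph \<Rightarrow> bool" where
  "is_generalized_line_graph G \<longleftrightarrow>
     (\<exists>(H :: nat pair_pre_digraph) a. pair_graph H \<and>
        digraph_iso (with_proj G) (with_proj (generalized_line_graph H a)))"

definition E8_roots :: "int vec set" where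
  "E8_roots =
     {x \<in> carrier_vec 8. \<exists>i < 8. \<exists>j < 8. i \<noteq> j \<and> x $ i \<in> {2, -2} \<and> x $ j \<in> {2, -2} \<and>
        (\<forall>k < 8. k \<noteq> i \<longrightarrow> k \<noteq> j \<longrightarrow> x $ k = 0)} \<union>
     {x \<in> carrier_vec 8. (\<forall>k < 8. x $ k \<in> {1, -1}) \<and> even (card {k. k < 8 \<and> x $ k = -1})}"

definition E8_representable :: "'a pair_pre_digraph \<Rightarrow> bool" where
  "E8_representable G \<longleftrightarrow>
     (\<exists>f. inj_on f (pverts G) \<and> f ` pverts G \<subseteq> E8_roots \<and>
        (\<forall>u \<in> pverts G. \<forall>v \<in> pverts G. u \<noteq> v \<longrightarrow>
           f u \<bullet> f v = (if (u, v) \<in> parcs G then 4 else 0)))"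

definition exceptional :: "'a pair_pre_digraph \<Rightarrow> bool" where
  "exceptional G \<longleftrightarrow>
     Digraph_Component.connected (with_proj G) \<and> \<not> is_generalized_line_graph G \<and>
     E8_representable G"

end

theory Submission
  imports Defs "HOL-Analysis.Function_Topology" "Jordan_Normal_Form.Spectral_Radius"
begin

text \<open>
  Write \<open>t\<close> for minus the smallest eigenvalue, so \<open>t < 2\<close>. Then the roots representing the
  vertices are linearly independent, and \<open>G\<close> has at most 8 vertices. Equality in Hoffman's bound
  forces the Perron vector \<open>x\<close> to be balanced: a vertex \<open>v\<close> outside a colour class sees total
  weight \<open>t * x v\<close> in it. Hence every two colour classes induce a bipartite graph all of whose
  components have spectral radius \<open>t < 2\<close>. There are at least three classes on at most 8 vertices,
  so some class has at most two vertices, and a short case analysis leaves \<open>t = 1\<close>, where \<open>G\<close> is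
  complete, or \<open>t\<close> the golden ratio, where any two classes induce a path on four vertices. In the
  latter case four classes violate the smallest eigenvalue, and three classes give the 3-sun, which
  is the line graph of the net and therefore not exceptional.
\<close>

section \<open>Rayleigh quotients of the adjacency matrix\<close>

text \<open>A nonnegative quadratic that vanishes at \<open>t = 0\<close> has slope zero
  there.\<close>

lemma linear_coeff_zero:
  fixes s d :: real
  assumes "\<And>t. 0 \<le> 2 * t * s + t^2 * d"
  shows "s = 0"
proof (rule ccontr)
  assume "s \<noteq> 0"
  \<comment> \<open>Adding 1 keeps \<open>e\<close> positive even for \<open>d = 0\<close>. Since
    \<open>d < 2 * e\<close>, the quadratic is negative at \<open>t = - s / e\<close>.\<close>
  define e where "e = \<bar>d\<bar> + 1"
  have e: "e > 0" "d < 2 * e" by (auto simp: e_def)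
  have "2 * (- s / e) * s + (- s / e)^2 * d = s^2 / e^2 * (d - 2 * e)"
    using e by (simp add: field_simps power2_eq_square)
  moreover have "\<dots> < 0"
    using e \<open>s \<noteq> 0\<close> by (intro mult_pos_neg) auto
  ultimately show False using assms[of "- s / e"] by simp
qed

text \<open>A null vector minimises a positive semidefinite form, so the first variation at
  \<open>y\<close> vanishes in every coordinate direction.\<close>

lemma psd_null_vector:
  fixes m :: "'a \<Rightarrow> 'a \<Rightarrow> real"
  assumes fin: "finite V"
    and sym: "\<And>u v. u \<in> V \<Longrightarrow> v \<in> V \<Longrightarrow> m u v = m v u"
    and psd: "\<And>x. 0 \<le> (\<Sum>u\<in>V. \<Sum>v\<in>V. m u v * x u * x v)"
    and null: "(\<Sum>u\<in>V. \<Sum>v\<in>V. m u v * y u * y v) = 0"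
    and u: "u \<in> V"
  shows "(\<Sum>v\<in>V. m u v * y v) = 0"
proof (rule linear_coeff_zero)
  fix t :: real
  \<comment> \<open>The coordinate vector at \<open>u\<close>. Along \<open>y + t * ?d\<close> the
    form is a quadratic in \<open>t\<close> whose linear coefficient is twice the wanted row
    sum.\<close>
  let ?d = "\<lambda>v. if v = u then 1 else (0::real)"
  have "0 \<le> (\<Sum>a\<in>V. \<Sum>b\<in>V. m a b * (y a + t * ?d a) * (y b + t * ?d b))"
    by (rule psd)
  also have "\<dots> = (\<Sum>a\<in>V. \<Sum>b\<in>V. m a b * y a * y b)
      + t * (\<Sum>a\<in>V. \<Sum>b\<in>V. if b = u then m a b * y a else 0)
      + t * (\<Sum>a\<in>V. \<Sum>b\<in>V. if a = u then m a b * y b else 0)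
      + t^2 * (\<Sum>a\<in>V. \<Sum>b\<in>V. if b = u then (if a = u then m a b else 0) else 0)"
    unfolding sum_distrib_left sum.distrib[symmetric]
    by (intro sum.cong refl) (auto simp: algebra_simps power2_eq_square)
  also have "(\<Sum>a\<in>V. \<Sum>b\<in>V. if b = u then m a b * y a else 0) = (\<Sum>v\<in>V. m u v * y v)"
    using fin u sym by (auto simp: sum.delta intro!: sum.cong)
  also have "(\<Sum>a\<in>V. \<Sum>b\<in>V. if a = u then m a b * y b else 0) = (\<Sum>v\<in>V. m u v * y v)"
    using fin u by (subst sum.swap) (auto simp: sum.delta)
  also have "(\<Sum>a\<in>V. \<Sum>b\<in>V. if b = u then (if a = u then m a b else 0) else 0) = m u u"
    using fin u by (simp add: sum.delta)
  finally show "0 \<le> 2 * t * (\<Sum>v\<in>V. m u v * y v) + t^2 * m u u"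
    using null by (simp add: algebra_simps)
qed

lemma symmetric_form_shift:
  fixes m :: "'a \<Rightarrow> 'a \<Rightarrow> real"
  assumes "finite V"
  shows "(\<Sum>u\<in>V. \<Sum>v\<in>V. (m u v - (if u = v then l else 0)) * x u * x v)
     = (\<Sum>u\<in>V. \<Sum>v\<in>V. m u v * x u * x v) - l * (\<Sum>v\<in>V. (x v)^2)"
proof -
  have "(\<Sum>u\<in>V. \<Sum>v\<in>V. (m u v - (if u = v then l else 0)) * x u * x v)
     = (\<Sum>u\<in>V. \<Sum>v\<in>V. m u v * x u * x v - (if u = v then l * (x u)^2 else 0))"
    by (intro sum.cong refl) (auto simp: algebra_simps power2_eq_square)
  also have "\<dots> = (\<Sum>u\<in>V. \<Sum>v\<in>V. m u v * x u * x v) - l * (\<Sum>v\<in>V. (x v)^2)"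
    using assms by (simp add: sum_subtractf sum_distrib_left)
  finally show ?thesis .
qed

text \<open>Subtracting \<open>l\<close> on the diagonal turns the bound into positive
  semidefiniteness and makes \<open>y\<close> a null vector. Applied to the negated matrix, this
  covers maximisers as well.\<close>

lemma rayleigh_extremal_eigenvector:
  fixes m :: "'a \<Rightarrow> 'a \<Rightarrow> real"
  assumes fin: "finite V"
    and sym: "\<And>u v. u \<in> V \<Longrightarrow> v \<in> V \<Longrightarrow> m u v = m v u"
    and bound: "\<And>x. l * (\<Sum>v\<in>V. (x v)^2) \<le> (\<Sum>u\<in>V. \<Sum>v\<in>V. m u v * x u * x v)"
    and eq: "(\<Sum>u\<in>V. \<Sum>v\<in>V. m u v * y u * y v) = l * (\<Sum>v\<in>V. (y v)^2)"
    and u: "u \<in> V"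
  shows "(\<Sum>v\<in>V. m u v * y v) = l * y u"
proof -
  have "(\<Sum>v\<in>V. (m u v - (if u = v then l else 0)) * y v) = 0"
    using fin sym bound eq u
    by (intro psd_null_vector) (auto simp: symmetric_form_shift)
  moreover have "(\<Sum>v\<in>V. (m u v - (if u = v then l else 0)) * y v)
      = (\<Sum>v\<in>V. m u v * y v - (if u = v then l * y v else 0))"
    by (intro sum.cong refl) (auto simp: algebra_simps)
  ultimately show ?thesis
    using fin u by (simp add: sum_subtractf)
qed

text \<open>The form attains its minimum \<open>l\<close> on the compact unit sphere, and
  homogeneity carries the bound to all vectors.\<close>

lemma rayleigh_minimum_exists:
  fixes m :: "'a \<Rightarrow> 'a \<Rightarrow> real"
  assumes fin: "finite V" and ne: "V \<noteq> {}"
  obtains l y where "\<exists>v\<in>V. y v \<noteq> 0"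
    and "\<And>x. l * (\<Sum>v\<in>V. (x v)^2) \<le> (\<Sum>u\<in>V. \<Sum>v\<in>V. m u v * x u * x v)"
    and "(\<Sum>u\<in>V. \<Sum>v\<in>V. m u v * y u * y v) = l * (\<Sum>v\<in>V. (y v)^2)"
proof -
  \<comment> \<open>Pinning functions to 0 outside \<open>V\<close> makes the box a product of
    compact sets even over an infinite vertex type, so that Tychonoff applies.\<close>
  define K where "K = PiE UNIV (\<lambda>i. if i \<in> V then {-1..1::real} else {0})"
  define S where "S = K \<inter> {x. (\<Sum>v\<in>V. (x v)^2) = 1}"
  let ?B = "\<lambda>x. \<Sum>u\<in>V. \<Sum>v\<in>V. m u v * x u * x v"
  have "compactin (product_topology (\<lambda>_. euclidean) UNIV) K"
    unfolding K_def compactin_PiE by auto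
  hence "compact K"
    by (simp add: euclidean_product_topology)
  moreover have "closed {x::'a \<Rightarrow> real. (\<Sum>v\<in>V. (x v)^2) = 1}"
    by (intro closed_Collect_eq continuous_intros continuous_on_product_coordinates)
  ultimately have "compact S" unfolding S_def by (rule compact_Int_closed)
  moreover have "S \<noteq> {}"
  proof -
    obtain w where "w \<in> V" using ne by blast
    hence "(\<lambda>v. if v = w then 1 else 0) \<in> S"
      using fin by (auto simp: S_def K_def if_distrib[where f = "\<lambda>z. z^2"] cong: if_cong)
    thus ?thesis by blast
  qed
  moreover have "continuous_on S ?B"
    by (rule continuous_on_subset[of UNIV])
       (auto intro!: continuous_intros continuous_on_product_coordinates)
  ultimately obtain y where y: "y \<in> S" "\<And>x. x \<in> S \<Longrightarrow> ?B y \<le> ?B x"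
    using continuous_attains_inf[of S ?B] by blast
  have y1: "(\<Sum>v\<in>V. (y v)^2) = 1" using y by (simp add: S_def)
  show thesis
  proof (rule that[of y "?B y"])
    show "\<exists>v\<in>V. y v \<noteq> 0"
    proof (rule ccontr)
      assume "\<not> (\<exists>v\<in>V. y v \<noteq> 0)"
      hence "(\<Sum>v\<in>V. (y v)^2) = 0" by simp
      thus False using y1 by simp
    qed
    show "?B y = ?B y * (\<Sum>v\<in>V. (y v)^2)" using y1 by simp
    fix x :: "'a \<Rightarrow> real"
    define r where "r = (\<Sum>v\<in>V. (x v)^2)"
    have r0: "r \<ge> 0" unfolding r_def by (intro sum_nonneg) auto
    show "?B y * (\<Sum>v\<in>V. (x v)^2) \<le> ?B x"
    proof (cases "r = 0")
      case True
      hence "\<forall>v\<in>V. x v = 0" using fin by (simp add: r_def sum_nonneg_eq_0_iff)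
      thus ?thesis by simp
    next
      case False
      hence r: "r > 0" using r0 by simp
      \<comment> \<open>The normalised vector is cut off outside \<open>V\<close>, because members
        of \<open>K\<close> vanish there.\<close>
      define z where "z = (\<lambda>v. if v \<in> V then x v / sqrt r else 0)"
      have z2: "(\<Sum>v\<in>V. (z v)^2) = 1"
      proof -
        have "(\<Sum>v\<in>V. (z v)^2) = (\<Sum>v\<in>V. (x v)^2 / r)"
          using r by (intro sum.cong) (auto simp: z_def power_divide)
        also have "\<dots> = r / r" unfolding r_def by (rule sum_divide_distrib[symmetric])
        finally show ?thesis using r by simp
      qed
      have z1: "- 1 \<le> z v \<and> z v \<le> 1" if "v \<in> V" for v
      proof -
        have "(z v)^2 \<le> (\<Sum>v\<in>V. (z v)^2)"
          by (rule member_le_sum) (use that fin in auto)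
        hence "\<bar>z v\<bar> \<le> 1" using z2 abs_square_le_1 by auto
        thus ?thesis by auto
      qed
      have "z \<in> K"
        unfolding K_def by (rule PiE_I) (use z1 in \<open>auto simp: z_def\<close>)
      hence "z \<in> S" using z2 by (simp add: S_def)
      hence "?B y \<le> ?B z" by (rule y(2))
      also have "?B z = (\<Sum>u\<in>V. \<Sum>v\<in>V. m u v * x u * x v / r)"
        using r by (intro sum.cong) (auto simp: z_def)
      also have "\<dots> = ?B x / r" by (simp add: sum_divide_distrib)
      finally show ?thesis using r by (simp add: field_simps r_def)
    qed
  qed
qed

section \<open>Adjacency eigenvalues in terms of functions on the vertices\<close>

lemma adj_eigenvalues_iff:
  assumes fin: "finite (pverts G)"
  shows "k \<in> adj_eigenvalues G \<longleftrightarrow> (\<exists>y. (\<exists>v\<in>pverts G. y v \<noteq> 0) \<and>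
     (\<forall>u\<in>pverts G. (\<Sum>v\<in>pverts G. of_bool ((u, v) \<in> parcs G) * y v) = k * y u))"
    (is "_ \<longleftrightarrow> ?R")
proof -
  let ?V = "pverts G"
  have reindex: "(\<Sum>v\<in>?V. g v) = (\<Sum>i<length vs. g (vs ! i))"
    if "distinct vs" "set vs = ?V" for vs and g :: "'a \<Rightarrow> real"
    using that sum.reindex_bij_betw[OF bij_betw_nth[OF that(1) refl refl], of g]
    by simp
  show ?thesis
  proof
    assume "k \<in> adj_eigenvalues G"
    then obtain vs w where vs: "distinct vs" "set vs = ?V" and w: "eigenvector (adj_mat G vs) w k"
      by (auto simp: adj_eigenvalues_def eigenvalue_def)
    let ?n = "length vs"
    have wc: "dim_vec w = ?n" and w0: "w \<noteq> 0\<^sub>v ?n" and we: "adj_mat G vs *\<^sub>v w = k \<cdot>\<^sub>v w"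
      using w by (auto simp: eigenvector_def adj_mat_def)
    \<comment> \<open>\<open>idx\<close> inverts the enumeration \<open>vs\<close>, which turns the
      coordinate vector \<open>w\<close> into a function on vertices.\<close>
    define idx where "idx v = (THE i. i < ?n \<and> vs ! i = v)" for v
    have idx: "idx (vs ! i) = i" if "i < ?n" for i
      unfolding idx_def using that vs(1) by (auto simp: nth_eq_iff_index_eq)
    define y where "y v = vec_index w (idx v)" for v
    obtain i where "i < ?n" "vec_index w i \<noteq> 0"
      using w0 wc by (metis eq_vecI index_zero_vec)
    hence "vs ! i \<in> ?V \<and> y (vs ! i) \<noteq> 0"
      using vs by (auto simp: y_def idx simp flip: vs(2))
    moreover have "(\<Sum>v\<in>?V. of_bool ((u, v) \<in> parcs G) * y v) = k * y u" if u: "u \<in> ?V" for u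
    proof -
      obtain i where i: "i < ?n" "u = vs ! i" using u vs by (metis in_set_conv_nth)
      have "vec_index (adj_mat G vs *\<^sub>v w) i = k * vec_index w i"
        using we i wc by simp
      moreover have "vec_index (adj_mat G vs *\<^sub>v w) i
          = (\<Sum>j<?n. of_bool ((u, vs ! j) \<in> parcs G) * vec_index w j)"
        using i wc by (simp add: adj_mat_def scalar_prod_def lessThan_atLeast0 of_bool_def)
      ultimately show ?thesis
        using i by (simp add: reindex[OF vs] y_def idx)
    qed
    ultimately show ?R by blast
  next
    assume ?R
    then obtain y where y: "\<exists>v\<in>?V. y v \<noteq> 0"
      "\<And>u. u \<in> ?V \<Longrightarrow> (\<Sum>v\<in>?V. of_bool ((u, v) \<in> parcs G) * y v) = k * y u" by blast
    obtain vs where vs: "distinct vs" "set vs = ?V"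
      using finite_distinct_list[OF fin] by blast
    let ?n = "length vs"
    let ?w = "Matrix.vec ?n (\<lambda>i. y (vs ! i))"
    have "adj_mat G vs *\<^sub>v ?w = k \<cdot>\<^sub>v ?w"
    proof (rule eq_vecI)
      fix i assume "i < dim_vec (k \<cdot>\<^sub>v ?w)"
      hence i: "i < ?n" by simp
      hence "vs ! i \<in> ?V" using vs nth_mem by blast
      from y(2)[OF this] show "vec_index (adj_mat G vs *\<^sub>v ?w) i = vec_index (k \<cdot>\<^sub>v ?w) i"
        using i by (simp add: reindex[OF vs] adj_mat_def scalar_prod_def lessThan_atLeast0
            of_bool_def if_distrib cong: if_cong)
    qed (simp add: adj_mat_def)
    moreover have "?w \<noteq> 0\<^sub>v ?n"
    proof
      assume w0: "?w = 0\<^sub>v ?n"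
      obtain v where "v \<in> ?V" "y v \<noteq> 0" using y(1) by blast
      then obtain i where "i < ?n" "y (vs ! i) \<noteq> 0" using vs by (metis in_set_conv_nth)
      thus False using arg_cong[OF w0, of "\<lambda>w. vec_index w i"] by simp
    qed
    ultimately have "eigenvalue (adj_mat G vs) k"
      unfolding eigenvalue_def eigenvector_def by (intro exI[of _ ?w]) (auto simp: adj_mat_def)
    thus "k \<in> adj_eigenvalues G" using vs by (auto simp: adj_eigenvalues_def)
  qed
qed

text \<open>There are finitely many enumerations of the vertices, and each matrix has a finite
  spectrum. This is what makes \<open>Min\<close> and \<open>Max\<close> meaningful for the extreme
  eigenvalues.\<close>

lemma finite_adj_eigenvalues:
  assumes "finite (pverts G)"
  shows "finite (adj_eigenvalues G)"
proof -
  have "finite {vs. set vs \<subseteq> pverts G \<and> distinct vs}"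
    using assms by (rule finite_subset_distinct)
  hence "finite {vs. distinct vs \<and> set vs = pverts G}"
    by (rule finite_subset[rotated]) auto
  moreover have "finite {k. eigenvalue (adj_mat G vs) k}" for vs
    using card_finite_spectrum(1)[of "adj_mat G vs" "length vs"]
    by (simp add: spectrum_def adj_mat_def)
  moreover have "adj_eigenvalues G =
      (\<Union>vs\<in>{vs. distinct vs \<and> set vs = pverts G}. {k. eigenvalue (adj_mat G vs) k})"
    by (auto simp: adj_eigenvalues_def)
  ultimately show ?thesis by simp
qed

text \<open>The quadratic form of the adjacency matrix; ordered pairs are summed, so each edge
  counts twice.\<close>

definition adj_form :: "'a pair_pre_digraph \<Rightarrow> ('a \<Rightarrow> real) \<Rightarrow> real" where
  "adj_form G x = (\<Sum>u\<in>pverts G. \<Sum>v\<in>pverts G. of_bool ((u, v) \<in> parcs G) * x u * x v)"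

lemma adj_form_eigenvector:
  assumes "\<And>u. u \<in> pverts G \<Longrightarrow> (\<Sum>v\<in>pverts G. of_bool ((u, v) \<in> parcs G) * y v) = k * y u"
  shows "adj_form G y = k * (\<Sum>v\<in>pverts G. (y v)^2)"
proof -
  have "adj_form G y = (\<Sum>u\<in>pverts G. y u * (\<Sum>v\<in>pverts G. of_bool ((u, v) \<in> parcs G) * y v))"
    by (simp add: adj_form_def sum_distrib_left mult_ac)
  also have "\<dots> = (\<Sum>u\<in>pverts G. k * (y u)^2)"
    using assms by (intro sum.cong) (auto simp: power2_eq_square)
  finally show ?thesis by (simp add: sum_distrib_left)
qed

lemma adj_eigenvalue_form:
  assumes fin: "finite (pverts G)" and k: "k \<in> adj_eigenvalues G"
  shows "\<exists>z. (\<exists>v\<in>pverts G. z v \<noteq> 0) \<and> adj_form G z = k * (\<Sum>v\<in>pverts G. (z v)^2)"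
proof -
  obtain z where "\<exists>v\<in>pverts G. z v \<noteq> 0"
    and z: "\<forall>u\<in>pverts G. (\<Sum>v\<in>pverts G. of_bool ((u, v) \<in> parcs G) * z v) = k * z u"
    using k unfolding adj_eigenvalues_iff[OF fin] by (elim exE conjE) (rule that)
  moreover have "adj_form G z = k * (\<Sum>v\<in>pverts G. (z v)^2)"
    by (rule adj_form_eigenvector) (use z in simp)
  ultimately show ?thesis by blast
qed

lemma sum_squares_pos:
  fixes y :: "'a \<Rightarrow> real"
  assumes "finite V" "\<exists>v\<in>V. y v \<noteq> 0"
  shows "0 < (\<Sum>v\<in>V. (y v)^2)"
proof -
  obtain v where "v \<in> V" "y v \<noteq> 0" using assms(2) by blast
  thus ?thesis using assms(1) by (intro sum_pos2[of V v]) auto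
qed

text \<open>A minimiser of the Rayleigh quotient is an eigenvector, and every eigenvalue is the
  quotient of its eigenvectors. So the minimum \<open>l\<close> of the quotient is the least
  eigenvalue.\<close>

lemma rayleigh_lambda_min:
  assumes fin: "finite (pverts G)" and ne: "pverts G \<noteq> {}" and sym: "sym (parcs G)"
  shows "lambda_min G * (\<Sum>v\<in>pverts G. (x v)^2) \<le> adj_form G x"
proof -
  let ?m = "\<lambda>u v. of_bool ((u, v) \<in> parcs G) :: real"
  have m: "?m u v = ?m v u" for u v using sym by (auto dest: symD)
  obtain l y where y: "\<exists>v\<in>pverts G. y v \<noteq> 0"
    and b: "\<And>x. l * (\<Sum>v\<in>pverts G. (x v)^2) \<le> adj_form G x"
    and e: "adj_form G y = l * (\<Sum>v\<in>pverts G. (y v)^2)"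
    by (rule rayleigh_minimum_exists[OF fin ne, of ?m, folded adj_form_def]) (rule that, auto)
  have "(\<Sum>v\<in>pverts G. ?m u v * y v) = l * y u" if "u \<in> pverts G" for u
    using rayleigh_extremal_eigenvector[OF fin, of ?m] m b e that unfolding adj_form_def by blast
  hence "l \<in> adj_eigenvalues G" using y adj_eigenvalues_iff[OF fin] by blast
  moreover have "l \<le> k" if k: "k \<in> adj_eigenvalues G" for k
  proof -
    obtain z where z: "\<exists>v\<in>pverts G. z v \<noteq> 0" "adj_form G z = k * (\<Sum>v\<in>pverts G. (z v)^2)"
      using adj_eigenvalue_form[OF fin k] by blast
    from b[of z] z sum_squares_pos[OF fin z(1)] show ?thesis by simp
  qed
  ultimately have "lambda_min G = l"
    unfolding lambda_min_def using finite_adj_eigenvalues[OF fin] by (intro Min_eqI)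
  thus ?thesis using b by simp
qed

text \<open>The argument for the minimum, applied to the negated adjacency matrix. The second claim
  supplies the maximiser from which the Perron vector is made.\<close>

lemma rayleigh_lambda_max:
  assumes fin: "finite (pverts G)" and ne: "pverts G \<noteq> {}" and sym: "sym (parcs G)"
  shows "adj_form G x \<le> lambda_max G * (\<Sum>v\<in>pverts G. (x v)^2)"
    and "\<exists>y. (\<exists>v\<in>pverts G. y v \<noteq> 0) \<and> adj_form G y = lambda_max G * (\<Sum>v\<in>pverts G. (y v)^2)"
proof -
  let ?m = "\<lambda>u v. - of_bool ((u, v) \<in> parcs G) :: real"
  have m: "?m u v = ?m v u" for u v using sym by (auto dest: symD)
  have mf: "(\<Sum>u\<in>pverts G. \<Sum>v\<in>pverts G. ?m u v * x u * x v) = - adj_form G x" for x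
    by (simp add: adj_form_def sum_negf)
  obtain l y where y: "\<exists>v\<in>pverts G. y v \<noteq> 0"
    and b: "\<And>x. l * (\<Sum>v\<in>pverts G. (x v)^2) \<le> - adj_form G x"
    and e: "- adj_form G y = l * (\<Sum>v\<in>pverts G. (y v)^2)"
    by (rule rayleigh_minimum_exists[OF fin ne, of ?m, unfolded mf]) (rule that, auto)
  have "(\<Sum>v\<in>pverts G. ?m u v * y v) = l * y u" if "u \<in> pverts G" for u
    using rayleigh_extremal_eigenvector[OF fin, of ?m] m b e that unfolding mf by blast
  hence "(\<Sum>v\<in>pverts G. of_bool ((u, v) \<in> parcs G) * y v) = - l * y u" if "u \<in> pverts G" for u
    using that by (force simp: sum_negf)
  hence "- l \<in> adj_eigenvalues G" using y adj_eigenvalues_iff[OF fin] by blast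
  moreover have "k \<le> - l" if k: "k \<in> adj_eigenvalues G" for k
  proof -
    obtain z where z: "\<exists>v\<in>pverts G. z v \<noteq> 0" "adj_form G z = k * (\<Sum>v\<in>pverts G. (z v)^2)"
      using adj_eigenvalue_form[OF fin k] by blast
    have "l * (\<Sum>v\<in>pverts G. (z v)^2) \<le> - k * (\<Sum>v\<in>pverts G. (z v)^2)"
      using b[of z] z by simp
    hence "l \<le> - k" using sum_squares_pos[OF fin z(1)] by (rule mult_right_le_imp_le)
    thus ?thesis by simp
  qed
  ultimately have l: "lambda_max G = - l"
    unfolding lambda_max_def using finite_adj_eigenvalues[OF fin] by (intro Max_eqI)
  show "adj_form G x \<le> lambda_max G * (\<Sum>v\<in>pverts G. (x v)^2)" using b[of x] l by simp
  show "\<exists>y. (\<exists>v\<in>pverts G. y v \<noteq> 0) \<and> adj_form G y = lambda_max G * (\<Sum>v\<in>pverts G. (y v)^2)"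
    using y e l by auto
qed

section \<open>Weighted colourings with few vertices\<close>

text \<open>The local form of equality in Hoffman's bound. Required in both directions between
  disjoint classes, it says that \<open>x\<close> is an eigenvector for \<open>t\<close> of the
  bipartite graph between them.\<close>

definition weight_regular :: "('a \<Rightarrow> 'a \<Rightarrow> bool) \<Rightarrow> ('a \<Rightarrow> real) \<Rightarrow> real \<Rightarrow> 'a set \<Rightarrow> 'a set \<Rightarrow> bool" where
  "weight_regular adj x t U W \<longleftrightarrow> (\<forall>v\<in>U. (\<Sum>w\<in>W. of_bool (adj v w) * x w) = t * x v)"

lemma weight_regularD:
  "weight_regular adj x t U W \<Longrightarrow> v \<in> U \<Longrightarrow> (\<Sum>w\<in>W. of_bool (adj v w) * x w) = t * x v"
  by (simp add: weight_regular_def)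

lemma real_eq_nat_below_two:
  assumes "0 < t" "t < 2" "t = real n"
  shows "t = 1"
proof -
  have "n = 1" using assms by auto
  thus ?thesis using assms by simp
qed

lemma sum_of_bool_card:
  "finite W \<Longrightarrow> (\<Sum>w\<in>W. of_bool (P w)) = real (card {w\<in>W. P w})"
  by (simp add: Int_def conj_commute)

text \<open>Positive weights force every vertex of \<open>W\<close> and \<open>Z\<close> to be
  adjacent to \<open>u\<close> and to have weight \<open>x u / t\<close>. Regularity between
  \<open>W\<close> and \<open>Z\<close> then makes \<open>t\<close> a number of neighbours, and the
  only integer strictly between 0 and 2 is 1.\<close>

lemma singleton_class_trivial:
  assumes t: "0 < t" "t < 2" and xu: "x u > 0" and xW: "\<And>w. w \<in> W \<Longrightarrow> x w > 0"
    and xZ: "\<And>z. z \<in> Z \<Longrightarrow> x z > 0" and W: "W \<noteq> {}" and Z: "finite Z"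
    and WU: "weight_regular adj x t W {u}" and ZU: "weight_regular adj x t Z {u}"
    and WZ: "weight_regular adj x t W Z"
  shows "t = 1"
proof -
  have eq: "x u = t * x w" if "weight_regular adj x t Y {u}" "w \<in> Y" "x w > 0" for w Y
    using weight_regularD[OF that(1,2)] that(3) t by (cases "adj w u") auto
  obtain w where w: "w \<in> W" using W by blast
  have "t * x w = (\<Sum>z\<in>Z. of_bool (adj w z) * x z)"
    using weight_regularD[OF WZ w] by simp
  also have "\<dots> * t = (\<Sum>z\<in>Z. of_bool (adj w z) * (t * x z))"
    by (simp add: sum_distrib_left sum_distrib_right mult_ac)
  also have "\<dots> = (\<Sum>z\<in>Z. of_bool (adj w z) * x u)"
    using eq[OF ZU] xZ by (intro sum.cong) auto
  also have "\<dots> = real (card {z\<in>Z. adj w z}) * x u"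
    by (simp only: sum_distrib_right[symmetric] sum_of_bool_card[OF Z])
  finally have "t * x u = real (card {z\<in>Z. adj w z}) * x u"
    using eq[OF WU w xW[OF w]] by (simp add: mult_ac)
  hence "t = real (card {z\<in>Z. adj w z})" using xu by simp
  thus ?thesis using t real_eq_nat_below_two by blast
qed

text \<open>The equations describe a positive eigenvector of the path \<open>b - c - a - d\<close>.
  Its spectral radius is the golden ratio, and its weights are symmetric under reversal and smaller
  at the ends.\<close>

lemma P4_weights:
  fixes a b c d t :: real
  assumes pos: "a > 0" "b > 0" "c > 0" "d > 0" "t > 0"
    and eqs: "c + d = t * a" "c = t * b" "a + b = t * c" "a = t * d"
  shows "t^2 = t + 1" "a = c" "b = d" "b < a" "d < c"
proof -
  have a: "a = (t^2 - 1) * b" using eqs by (simp add: algebra_simps power2_eq_square)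
  hence t1: "t^2 > 1" using pos by (simp add: zero_less_mult_iff)
  have t1': "t > 1"
  proof (rule ccontr)
    assume "\<not> t > 1"
    hence "t^2 \<le> 1" using pos by (intro power_le_one) auto
    thus False using t1 by simp
  qed
  have "t * (t * a) = t * c + t * d" by (simp flip: eqs(1) add: distrib_left)
  also have "t * c = t^2 * b" using eqs(2) by (simp add: power2_eq_square)
  also have "t * d = (t^2 - 1) * b" using eqs(4) a by simp
  finally have "(t^2 * (t^2 - 1) - (2 * t^2 - 1)) * b = 0"
    using a by (simp add: algebra_simps power2_eq_square)
  hence "t^2 * (t^2 - 1) - (2 * t^2 - 1) = 0" using pos by simp
  \<comment> \<open>The right-hand side is \<open>t^4 - 3 * t^2 + 1\<close>, the characteristic
    polynomial of the path. The second factor is positive because \<open>t^2 > 1\<close>.\<close>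
  moreover have "(t^2 - t - 1) * (t^2 + t - 1) = t^2 * (t^2 - 1) - (2 * t^2 - 1)"
    by (simp add: algebra_simps power2_eq_square)
  ultimately have "(t^2 - t - 1) * (t^2 + t - 1) = 0" by simp
  moreover have "t^2 + t - 1 > 0" using t1 pos by linarith
  ultimately show tt: "t^2 = t + 1" by auto
  have "a = t * b" using a tt by simp
  thus "a = c" using eqs by simp
  thus "b = d" using eqs pos by simp
  show "b < a" "d < c" using \<open>a = t * b\<close> \<open>a = c\<close> \<open>b = d\<close> t1' pos by auto
qed

text \<open>Positive weights rule out isolated vertices, which leaves two perfect matchings, the
  4-cycle and four paths. Matchings force \<open>t = 1\<close> and the 4-cycle forces
  \<open>t = 2\<close>. Of the paths, the ordering of the weights keeps only the one with ends
  \<open>v\<close> and \<open>z\<close>.\<close>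

lemma two_by_two_classes:
  assumes t: "0 < t" "t < 2" "t \<noteq> 1" and sym: "\<And>a b. adj a b \<Longrightarrow> adj b a"
    and ne: "u \<noteq> v" "w \<noteq> z" and pos: "x u > 0" "x v > 0" "x w > 0" "x z > 0"
    and UW: "weight_regular adj x t {u, v} {w, z}" and WU: "weight_regular adj x t {w, z} {u, v}"
    and le: "x v \<le> x u" "x z \<le> x w"
  shows "t^2 = t + 1" "adj u w" "adj u z" "adj v w" "\<not> adj v z"
proof -
  have s: "adj w u = adj u w" "adj w v = adj v w" "adj z u = adj u z" "adj z v = adj v z"
    using sym by blast+
  have e: "of_bool (adj u w) * x w + of_bool (adj u z) * x z = t * x u"
    "of_bool (adj v w) * x w + of_bool (adj v z) * x z = t * x v"
    "of_bool (adj u w) * x u + of_bool (adj v w) * x v = t * x w"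
    "of_bool (adj u z) * x u + of_bool (adj v z) * x v = t * x z"
    using UW WU ne by (auto simp: weight_regular_def s)
  have tpos: "t * x u > 0" "t * x v > 0" "t * x w > 0" "t * x z > 0" using t pos by auto
  \<comment> \<open>An isolated edge has eigenvalue 1: the two equations give
    \<open>t^2 = 1\<close>.\<close>
  have match: False if "a = t * b" "b = t * a" "a > 0" for a b
  proof -
    have "t * (t * a) = a" using that(1,2) by metis
    hence "(t - 1) * (t + 1) * a = 0" by (simp add: algebra_simps)
    thus False using t that(3) by auto
  qed
  have "adj u w \<or> adj u z" using e(1) tpos(1) by (cases "adj u w"; cases "adj u z"; cases "adj v w") auto
  moreover have "adj v w \<or> adj v z" using e(2) tpos(2) by (cases "adj v w"; cases "adj v z") auto
  moreover have "adj u w \<or> adj v w" using e(3) tpos(3) by (cases "adj u w"; cases "adj u z"; cases "adj v w") auto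
  moreover have "adj u z \<or> adj v z" using e(4) tpos(4) by (cases "adj u z"; cases "adj v z") auto
  ultimately consider "adj u w" "adj v z" "\<not> adj u z" "\<not> adj v w" | "\<not> adj u w" "\<not> adj v z" "adj u z" "adj v w"
    | "adj u w" "adj v z" "adj u z" "adj v w" | "\<not> adj u w" "adj v z" "adj u z" "adj v w"
    | "adj u w" "\<not> adj v z" "adj u z" "adj v w" | "adj u w" "adj v z" "\<not> adj u z" "adj v w"
    | "adj u w" "adj v z" "adj u z" "\<not> adj v w" by blast
  hence *: "t^2 = t + 1 \<and> adj u w \<and> adj u z \<and> adj v w \<and> \<not> adj v z"
  proof cases
    case 1
    thus ?thesis using match[of "x u" "x w"] e pos by simp
  next
    case 2
    thus ?thesis using match[of "x u" "x z"] e pos by simp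
  next
    \<comment> \<open>The 4-cycle: weights are constant on each class, hence
      \<open>t^2 = 4\<close>.\<close>
    case 3
    hence f: "x w + x z = t * x u" "x w + x z = t * x v" "x u + x v = t * x w" "x u + x v = t * x z"
      using e by simp_all
    hence "x u = x v" "x w = x z" using t by (metis mult_left_cancel order_less_irrefl)+
    hence a: "t * x u = 2 * x w" "t * x w = 2 * x u" using f by simp_all
    have "t * (t * x u) = 2 * (t * x w)" by (simp add: a(1))
    hence "(t - 2) * (t + 2) * x u = 0" unfolding a(2) by (simp add: algebra_simps)
    thus ?thesis using t pos by auto
  next
    case 4
    thus ?thesis using P4_weights(4)[of "x v" "x u" "x z" "x w" t] e pos t le by simp
  next
    case 5
    thus ?thesis using P4_weights(1)[of "x u" "x v" "x w" "x z" t] e pos t by simp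
  next
    case 6
    thus ?thesis using P4_weights(4)[of "x v" "x u" "x w" "x z" t] e pos t le by simp
  next
    case 7
    thus ?thesis using P4_weights(5)[of "x u" "x v" "x z" "x w" t] e pos t le by simp
  qed
  show "t^2 = t + 1" "adj u w" "adj u z" "adj v w" "\<not> adj v z" using * by auto
qed

text \<open>Regularity is applied twice, along walks from \<open>u\<close> or \<open>v\<close>
  through \<open>W\<close> and back to \<open>{u, v}\<close>. Private neighbours return to their
  only neighbour, common ones to both; no vertex of \<open>W\<close> misses both, since its weight
  is positive.\<close>

lemma two_class_counts:
  assumes t: "0 < t" and sym: "\<And>a b. adj a b \<Longrightarrow> adj b a" and uv: "u \<noteq> v"
    and fin: "finite W" and xW: "\<And>w. w \<in> W \<Longrightarrow> x w > 0"
    and UW: "weight_regular adj x t {u, v} W" and WU: "weight_regular adj x t W {u, v}"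
  defines "a \<equiv> card {w\<in>W. adj u w \<and> \<not> adj v w}"
    and "b \<equiv> card {w\<in>W. adj v w \<and> \<not> adj u w}"
    and "c \<equiv> card {w\<in>W. adj u w \<and> adj v w}"
  shows "card W = a + b + c"
    and "t^2 * x u = real a * x u + real c * (x u + x v)"
    and "t^2 * x v = real b * x v + real c * (x u + x v)"
proof -
  have sym': "adj a b = adj b a" for a b using sym by blast
  have nb: "t * x w = of_bool (adj u w) * x u + of_bool (adj v w) * x v" if "w \<in> W" for w
    using weight_regularD[OF WU that] uv by (simp add: sym'[of w] del: sum_of_bool_mult_eq)
  have "adj u w \<or> adj v w" if "w \<in> W" for w
    using nb[OF that] xW[OF that] t by (metis add.right_neutral mult_eq_0_iff mult_pos_pos of_bool_eq(1) order_less_irrefl)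
  hence W: "W = ({w\<in>W. adj u w \<and> \<not> adj v w} \<union> {w\<in>W. adj v w \<and> \<not> adj u w}) \<union> {w\<in>W. adj u w \<and> adj v w}"
    by auto
  have "card W = card ({w\<in>W. adj u w \<and> \<not> adj v w} \<union> {w\<in>W. adj v w \<and> \<not> adj u w}) + c"
    unfolding c_def by (subst W, subst card_Un_disjoint) (use fin in auto)
  also have "\<dots> = a + b + c"
    unfolding a_def b_def by (subst card_Un_disjoint) (use fin in auto)
  finally show "card W = a + b + c" .
  have "t^2 * x u = (\<Sum>w\<in>W. of_bool (adj u w) * (t * x w))"
    using weight_regularD[OF UW, of u]
    by (simp add: power2_eq_square mult.assoc mult.left_commute sum_distrib_left flip: sum_distrib_left)
  also have "\<dots> = (\<Sum>w\<in>W. of_bool (adj u w \<and> \<not> adj v w) * x u + of_bool (adj u w \<and> adj v w) * (x u + x v))"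
    by (intro sum.cong refl) (auto simp: nb)
  also have "\<dots> = real a * x u + real c * (x u + x v)"
    by (simp only: sum.distrib sum_distrib_right[symmetric] sum_of_bool_card[OF fin] a_def c_def)
  finally show "t^2 * x u = real a * x u + real c * (x u + x v)" .
  have "t^2 * x v = (\<Sum>w\<in>W. of_bool (adj v w) * (t * x w))"
    using weight_regularD[OF UW, of v]
    by (simp add: power2_eq_square mult.assoc mult.left_commute sum_distrib_left flip: sum_distrib_left)
  also have "\<dots> = (\<Sum>w\<in>W. of_bool (adj v w \<and> \<not> adj u w) * x v + of_bool (adj u w \<and> adj v w) * (x u + x v))"
    by (intro sum.cong refl) (auto simp: nb)
  also have "\<dots> = real b * x v + real c * (x u + x v)"
    by (simp only: sum.distrib sum_distrib_right[symmetric] sum_of_bool_card[OF fin] b_def c_def)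
  finally show "t^2 * x v = real b * x v + real c * (x u + x v)" .
qed

text \<open>Adding the equations gives \<open>t^2 \<ge> 2 * c\<close>, so two common neighbours,
  that is a 4-cycle, would force \<open>t \<ge> 2\<close>.\<close>

lemma common_neighbours_le_one:
  fixes t xu xv :: real
  assumes "0 < t" "t < 2" "xu > 0" "xv > 0"
    and "t^2 * xu = real a * xu + real c * (xu + xv)" "t^2 * xv = real b * xv + real c * (xu + xv)"
  shows "c \<le> 1"
proof (rule ccontr)
  assume "\<not> c \<le> 1"
  hence c: "real c \<ge> 2" by simp
  have "t^2 * (xu + xv) = real a * xu + real b * xv + 2 * real c * (xu + xv)"
    using assms(5,6) by (simp add: algebra_simps)
  also have "\<dots> \<ge> 4 * (xu + xv)"
    using assms(3,4) c mult_right_mono[of 4 "2 * real c" "xu + xv"] by (smt (verit) mult_nonneg_nonneg of_nat_0_le_iff)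
  finally have "t^2 \<ge> 4" using assms(3,4) mult_right_le_imp_le[of 4 "xu + xv" "t^2"] by simp
  moreover have "t^2 < 2^2" using assms(1,2) by (intro power_strict_mono) auto
  ultimately show False by simp
qed

lemma golden_bounds:
  fixes t :: real
  assumes "0 < t" "t^2 = t + 1"
  shows "8/5 < t" "t < 81/50"
proof -
  have "t * t = t + 1" using assms(2) by (simp add: power2_eq_square)
  moreover have "t * t \<le> 8/5 * t" if "t \<le> 8/5" using that assms(1) by (intro mult_right_mono) auto
  moreover have "81/50 * t \<le> t * t" if "81/50 \<le> t" using that assms(1) by (intro mult_right_mono) auto
  ultimately show "8/5 < t" "t < 81/50" by linarith+
qed

text \<open>Without a common neighbour \<open>t + 1\<close> would be an integer, so there is exactly
  one. Eliminating the weights leaves \<open>(t - a) * (t - b) = 1\<close> with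
  \<open>a, b < 2\<close>, which for the golden ratio happens only when
  \<open>a + b = 1\<close>.\<close>

lemma golden_class_card:
  assumes t: "0 < t" "t < 2" "t^2 = t + 1" and sym: "\<And>a b. adj a b \<Longrightarrow> adj b a" and uv: "u \<noteq> v"
    and xuv: "x u > 0" "x v > 0"
    and fin: "finite W" and xW: "\<And>w. w \<in> W \<Longrightarrow> x w > 0"
    and UW: "weight_regular adj x t {u, v} W" and WU: "weight_regular adj x t W {u, v}"
  shows "card W = 2"
proof -
  obtain a b c where cd: "card W = a + b + c"
    and e: "t^2 * x u = real a * x u + real c * (x u + x v)"
      "t^2 * x v = real b * x v + real c * (x u + x v)"
    using two_class_counts[OF t(1) sym uv fin xW UW WU] by (rule that)
  note g = golden_bounds[OF t(1,3)]
  have "c \<le> 1" using common_neighbours_le_one[OF t(1,2) xuv e] .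
  moreover have "c \<noteq> 0"
  proof
    assume "c = 0"
    hence "t^2 * x u = real a * x u" using e by simp
    hence "t + 1 = real a" using t xuv by simp
    hence "t = real (a - 1)" using t by (cases a) auto
    hence "t = 1" using t real_eq_nat_below_two by blast
    thus False using g by simp
  qed
  ultimately have c: "c = 1" by simp
  have e': "(t - real a) * x u = x v" "(t - real b) * x v = x u"
    using e t c by (simp_all add: algebra_simps)
  have "t - real a > 0" "t - real b > 0" using e' xuv by (metis zero_less_mult_pos2)+
  hence ab: "a < 2" "b < 2" using g by linarith+
  have "(t - real a) * (t - real b) * x u = (t - real b) * ((t - real a) * x u)" by simp
  also have "\<dots> = x u" by (simp only: e')
  finally have p: "(t - real a) * (t - real b) = 1" using xuv by simp
  have "a + b = 1"
  proof -
    consider "a = 0" "b = 0" | "a = 1" "b = 1" | "a + b = 1" using ab by linarith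
    thus ?thesis
    proof cases
      case 1 thus ?thesis using p t g by (simp add: power2_eq_square)
    next
      case 2 thus ?thesis using p t g by (simp add: power2_eq_square algebra_simps)
    qed
  qed
  thus ?thesis using cd c by simp
qed

text \<open>A private neighbour \<open>w\<close> of \<open>u\<close> has weight
  \<open>x u / t\<close>. Expanding \<open>x w\<close> through the third class \<open>Z\<close> and
  then through \<open>{u, v}\<close> yields a relation linear in \<open>t\<close>; \<open>p\<close>
  and \<open>q\<close> count the paths from \<open>w\<close> through \<open>Z\<close> to
  \<open>u\<close> and to \<open>v\<close>.\<close>

lemma pure_neighbour_weights:
  assumes t: "0 < t" and sym: "\<And>a b. adj a b \<Longrightarrow> adj b a" and uv: "u \<noteq> v"
    and fin: "finite Z" and w: "w \<in> W" "adj u w" "\<not> adj v w"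
    and WU: "weight_regular adj x t W {u, v}" and ZU: "weight_regular adj x t Z {u, v}"
    and WZ: "weight_regular adj x t W Z"
  obtains p q :: nat where "t * x u = real p * x u + real q * x v"
proof -
  have sym': "adj a b = adj b a" for a b using sym by blast
  have xw: "t * x w = x u"
    using weight_regularD[OF WU w(1)] w(2,3) uv by (simp add: sym'[of w] del: sum_of_bool_mult_eq)
  have "t * x u = t * (\<Sum>z\<in>Z. of_bool (adj w z) * x z)"
    using xw weight_regularD[OF WZ w(1)] by simp
  also have "\<dots> = (\<Sum>z\<in>Z. of_bool (adj w z) * (t * x z))"
    by (simp add: sum_distrib_left mult_ac)
  also have "\<dots> = (\<Sum>z\<in>Z. of_bool (adj w z) * (of_bool (adj z u) * x u + of_bool (adj z v) * x v))"
    using weight_regularD[OF ZU, symmetric] uv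
    by (intro sum.cong) (simp_all del: sum_of_bool_mult_eq)
  also have "\<dots> = (\<Sum>z\<in>Z. of_bool (adj w z \<and> adj z u) * x u + of_bool (adj w z \<and> adj z v) * x v)"
    by (intro sum.cong) auto
  also have "\<dots> = real (card {z\<in>Z. adj w z \<and> adj z u}) * x u + real (card {z\<in>Z. adj w z \<and> adj z v}) * x v"
    by (simp only: sum.distrib sum_distrib_right[symmetric] sum_of_bool_card[OF fin])
  finally show thesis by (rule that)
qed

text \<open>The two quadratic equations belong to the Dynkin diagram D5. They determine the ratio
  \<open>r\<close> of the weights as \<open>sqrt 2 - 1\<close> and \<open>t\<close> as
  \<open>sqrt (2 + sqrt 2)\<close>, about 1.848, which is no combination \<open>p + q * r\<close>
  with natural coefficients.\<close>

lemma no_two_three_weights: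
  fixes t xu xv :: real
  assumes t: "0 < t" "t < 2" and pos: "xu > 0" "xv > 0"
    and e: "t^2 * xu = 3 * xu + xv" "t^2 * xv = xu + xv"
    and pq: "t * xu = real p * xu + real q * xv"
  shows False
proof -
  define r where "r = xv / xu"
  have xv: "xv = r * xu" and r0: "r > 0" using pos by (simp_all add: r_def)
  have "t^2 * xu = (3 + r) * xu" using e xv by (simp add: algebra_simps)
  hence s: "t^2 = 3 + r" using pos by simp
  have "(t^2 * r) * xu = (1 + r) * xu" using e xv by (simp add: algebra_simps)
  hence "t^2 * r = 1 + r" using pos by (metis mult_right_cancel order_less_irrefl)
  hence r: "r^2 + 2 * r = 1" using s by (simp add: power2_eq_square algebra_simps)
  \<comment> \<open>The bracket must be this narrow, since \<open>1 + 2 * r\<close>, about 1.828,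
    comes close to \<open>t\<close>.\<close>
  have rb: "207/500 < r" "r < 83/200"
  proof -
    have "r^2 \<le> (207/500)^2" if "r \<le> 207/500" using that r0 by (intro power_mono) auto
    thus "207/500 < r" using r by (cases "r \<le> 207/500") (auto simp: power2_eq_square)
    have "(83/200)^2 \<le> r^2" if "83/200 \<le> r" using that by (intro power_mono) auto
    thus "r < 83/200" using r by (cases "83/200 \<le> r") (auto simp: power2_eq_square)
  qed
  have tb: "1847/1000 < t" "t < 37/20"
  proof -
    have "(1847/1000)^2 < t^2" "t^2 < (37/20)^2" using s rb by (simp_all add: power2_eq_square)
    thus "1847/1000 < t" "t < 37/20"
      using t power_less_imp_less_base[of "1847/1000" 2 t] power_less_imp_less_base[of t 2 "37/20"] by simp_all
  qed
  have "t * xu = (real p + real q * r) * xu" using pq xv by (simp add: algebra_simps)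
  hence tpq: "t = real p + real q * r" using pos by simp
  have qr: "real q * (207/500) \<le> real q * r" "real q * r \<le> real q * (83/200)"
    by (rule mult_left_mono[OF less_imp_le[OF rb(1)] of_nat_0_le_iff],
        rule mult_left_mono[OF less_imp_le[OF rb(2)] of_nat_0_le_iff])
  \<comment> \<open>For each \<open>p\<close> the values \<open>p + q * r\<close> jump over
    \<open>t\<close>: from below at \<open>q = 2\<close> to above at \<open>q = 3\<close> for
    \<open>p = 1\<close>, and from \<open>q = 4\<close> to \<open>q = 5\<close> for
    \<open>p = 0\<close>.\<close>
  consider "p \<ge> 2" | "p = 1" "q \<le> 2" | "p = 1" "q \<ge> 3" | "p = 0" "q \<le> 4" | "p = 0" "q \<ge> 5" by linarith
  thus False
  proof cases
    case 1
    hence "real p \<ge> 2" by simp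
    moreover have "real q * r \<ge> 0" using r0 by simp
    ultimately show False using tpq t by linarith
  next
    case 2
    hence "real p = 1" "real q \<le> 2" by simp_all
    thus False using tpq tb qr by linarith
  next
    case 3
    hence "real p = 1" "real q \<ge> 3" by simp_all
    thus False using tpq tb qr by linarith
  next
    case 4
    hence "real p = 0" "real q \<le> 4" by simp_all
    thus False using tpq tb qr by linarith
  next
    case 5
    hence "real p = 0" "real q \<ge> 5" by simp_all
    thus False using tpq tb qr by linarith
  qed
qed

text \<open>There is exactly one common neighbour: \<open>c = 0\<close> would give
  \<open>a = b\<close> with \<open>a + b = 3\<close>. The two private neighbours then lie at one
  vertex, giving D5, or one at each, giving a path on five vertices with \<open>t^2 = 3\<close>. The
  linear relation coming from \<open>Z\<close> contradicts both.\<close>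

lemma no_two_three_three:
  assumes t: "0 < t" "t < 2" and sym: "\<And>a b. adj a b \<Longrightarrow> adj b a" and uv: "u \<noteq> v"
    and xuv: "x u > 0" "x v > 0"
    and W: "card W = 3" and xW: "\<And>w. w \<in> W \<Longrightarrow> x w > 0"
    and Z: "finite Z"
    and UW: "weight_regular adj x t {u, v} W" and WU: "weight_regular adj x t W {u, v}"
    and ZU: "weight_regular adj x t Z {u, v}" and WZ: "weight_regular adj x t W Z"
  shows False
proof -
  have fin: "finite W" using W card.infinite by fastforce
  define a b c where "a = card {w\<in>W. adj u w \<and> \<not> adj v w}"
    and "b = card {w\<in>W. adj v w \<and> \<not> adj u w}"
    and "c = card {w\<in>W. adj u w \<and> adj v w}"
  note cnt = two_class_counts[OF t(1) sym uv fin xW UW WU, folded a_def b_def c_def]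
  have u_pure: "\<exists>p q :: nat. t * x u = real p * x u + real q * x v" if "a > 0"
  proof -
    obtain w where "w \<in> W" "adj u w" "\<not> adj v w"
      using \<open>a > 0\<close> fin by (auto simp: a_def card_gt_0_iff)
    thus ?thesis using pure_neighbour_weights[OF t(1) sym uv Z _ _ _ WU ZU WZ] by metis
  qed
  have v_pure: "\<exists>p q :: nat. t * x v = real p * x v + real q * x u" if "b > 0"
  proof -
    obtain w where "w \<in> W" "adj v w" "\<not> adj u w"
      using \<open>b > 0\<close> fin by (auto simp: b_def card_gt_0_iff)
    thus ?thesis
      using pure_neighbour_weights[OF t(1) sym uv[symmetric] Z _ _ _ _ _ WZ] WU ZU
      by (metis insert_commute)
  qed
  have "c \<le> 1" using common_neighbours_le_one[OF t xuv cnt(2,3)] .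
  moreover have "c \<noteq> 0"
  proof
    assume "c = 0"
    hence "t^2 = real a" "t^2 = real b" using cnt(2,3) xuv by auto
    hence "a = b" by simp
    hence "a + a = 3" using cnt(1) W \<open>c = 0\<close> by linarith
    thus False by presburger
  qed
  ultimately have c: "c = 1" by simp
  hence "a + b = 2" using cnt(1) W by simp
  then consider "a = 2" "b = 0" | "a = 1" "b = 1" | "a = 0" "b = 2" by linarith
  thus False
  proof cases
    case 1
    then obtain p q where "t * x u = real p * x u + real q * x v" using u_pure by auto
    thus False using no_two_three_weights[OF t xuv, of p q] cnt(2,3) 1 c by simp
  next
    case 3
    then obtain p q where "t * x v = real p * x v + real q * x u" using v_pure by auto
    thus False using no_two_three_weights[OF t xuv(2,1), of p q] cnt(2,3) 3 c by simp
  next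
    \<comment> \<open>The path on five vertices: equal weights at \<open>u\<close> and
      \<open>v\<close> turn the linear relation into \<open>t = p + q\<close>, an integer.\<close>
    case 2
    then obtain p q where pq: "t * x u = real p * x u + real q * x v" using u_pure by auto
    have e: "t^2 * x u = 2 * x u + x v" "t^2 * x v = 2 * x v + x u" using cnt(2,3) 2 c by simp_all
    have "t^2 * x u > 1 * x u" using e xuv by simp
    hence "t^2 > 1" using xuv by (simp only: mult_less_cancel_right_disj) auto
    moreover have "(t^2 - 1) * (x u - x v) = 0" using e by (simp add: algebra_simps)
    ultimately have xx: "x u = x v" by auto
    hence "t * x u = real (p + q) * x u" using pq by (simp add: algebra_simps)
    hence "t = real (p + q)" using xuv by simp
    hence "t = 1" using t real_eq_nat_below_two by blast
    thus False using e xx xuv by simp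
  qed
qed

text \<open>No class is a singleton, so up to order the first three classes have sizes 2, 3, 3 or
  contain two of size 2. The former is excluded; the latter gives the golden ratio, which forces
  size 2 everywhere. \<open>h\<close> and \<open>l\<close> pick the heavier and the lighter vertex
  of a class.\<close>

lemma small_weighted_coloring:
  fixes cls :: "nat \<Rightarrow> 'a set"
  assumes k: "3 \<le> k" and small: "(\<Sum>i<k. card (cls i)) \<le> 8"
    and fin: "\<And>i. i < k \<Longrightarrow> finite (cls i)" and ne: "\<And>i. i < k \<Longrightarrow> cls i \<noteq> {}"
    and sym: "\<And>a b. adj a b \<Longrightarrow> adj b a"
    and pos: "\<And>i v. i < k \<Longrightarrow> v \<in> cls i \<Longrightarrow> x v > 0"
    and t: "0 < t" "t < 2" "t \<noteq> 1"
    and reg: "\<And>i j. i < k \<Longrightarrow> j < k \<Longrightarrow> i \<noteq> j \<Longrightarrow> weight_regular adj x t (cls i) (cls j)"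
  shows "\<exists>h l. t^2 = t + 1 \<and> k \<le> 4 \<and> (\<forall>i<k. cls i = {h i, l i} \<and> h i \<noteq> l i) \<and>
    (\<forall>i<k. \<forall>j<k. i \<noteq> j \<longrightarrow> adj (h i) (h j) \<and> adj (h i) (l j) \<and> \<not> adj (l i) (l j))"
proof -
  have "card (cls i) \<noteq> 1" if i: "i < k" for i
  proof
    assume "card (cls i) = 1"
    then obtain u where u: "cls i = {u}" by (auto simp: card_1_singleton_iff)
    have "\<exists>j m. j < k \<and> m < k \<and> j \<noteq> i \<and> m \<noteq> i \<and> j \<noteq> m"
      using k by (cases "i = 0"; cases "i = 1") (rule exI[of _ 1] exI[of _ 0], rule exI[of _ 2] exI[of _ 1], simp)+
    then obtain j m where "j < k" "m < k" "j \<noteq> i" "m \<noteq> i" "j \<noteq> m" by blast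
    hence "t = 1"
      using singleton_class_trivial[of t x u "cls j" "cls m" adj] t pos fin ne reg[of j i] reg[of m i] reg[of j m] u i
      by (metis insertI1)
    thus False using t by simp
  qed
  hence ge2: "card (cls i) \<ge> 2" if "i < k" for i
    using that fin ne by (metis One_nat_def Suc_1 card_eq_0_iff less_2_cases_iff linorder_not_le)
  have two: "\<exists>u v. cls i = {u, v} \<and> u \<noteq> v \<and> x v \<le> x u" if "card (cls i) = 2" for i
    using that by (metis card_2_iff insert_commute linorder_linear)
  have sum3: "card (cls 0) + card (cls 1) + card (cls 2) \<le> 8"
  proof -
    have "(\<Sum>i<3. card (cls i)) \<le> (\<Sum>i<k. card (cls i))"
      using k by (intro sum_mono2) auto
    thus ?thesis using small by (simp add: eval_nat_numeral)
  qed
  have no233: False if ij: "i < k" "j < k" "m < k" "i \<noteq> j" "j \<noteq> m" "i \<noteq> m"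
    and c2: "card (cls i) = 2" and c3: "card (cls j) = 3" for i j m
  proof -
    obtain u v where "cls i = {u, v}" "u \<noteq> v" using two[OF c2] by blast
    thus False
      using no_two_three_three[of t adj u v x "cls j" "cls m"] t(1,2) sym pos fin ij c3
        reg[of i j] reg[of j i] reg[of m i] reg[of j m] by (metis insertI1 insert_commute)
  qed
  have "\<exists>i j. i < k \<and> j < k \<and> i \<noteq> j \<and> card (cls i) = 2 \<and> card (cls j) = 2"
  proof (rule ccontr)
    assume n: "\<not> ?thesis"
    have n': False if "i < k" "j < k" "i \<noteq> j" "card (cls i) = 2" "card (cls j) = 2" for i j
      using n that by blast
    have l: "0 < k" "1 < k" "2 < k" using k by auto
    \<comment> \<open>Three sizes of at least 2 with sum at most 8 include two 2s or are 2, 3,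
      3.\<close>
    have arith: False if "p \<ge> 2" "q \<ge> 2" "r \<ge> 2" "p + q + r \<le> 8"
      "\<not> (p = 2 \<and> q = 2)" "\<not> (p = 2 \<and> r = 2)" "\<not> (q = 2 \<and> r = 2)"
      "\<not> (p = 2 \<and> q = 3)" "\<not> (q = 2 \<and> p = 3)" "\<not> (r = 2 \<and> p = 3)" for p q r :: nat
      using that by presburger
    show False
      by (rule arith[OF ge2[OF l(1)] ge2[OF l(2)] ge2[OF l(3)] sum3])
         (use n'[of 0 1] n'[of 0 2] n'[of 1 2] no233[of 0 1 2] no233[of 1 0 2] no233[of 2 0 1] l in auto)
  qed
  then obtain i j where ij: "i < k" "j < k" "i \<noteq> j" "card (cls i) = 2" "card (cls j) = 2" by blast
  obtain u v where uv: "cls i = {u, v}" "u \<noteq> v" "x v \<le> x u" using two[OF ij(4)] by blast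
  obtain w z where wz: "cls j = {w, z}" "w \<noteq> z" "x z \<le> x w" using two[OF ij(5)] by blast
  have g: "t^2 = t + 1"
    using two_by_two_classes(1)[of t adj u v w z x] t sym uv wz pos ij reg[of i j] reg[of j i]
    by (metis insertI1 insert_commute)
  have all2: "card (cls m) = 2" if "m < k" for m
    using golden_class_card[of t adj u v x "cls m"] t g sym uv pos fin that ij reg[of i m] reg[of m i]
    by (metis insertI1 insert_commute)
  have "\<exists>h l. \<forall>i. i < k \<longrightarrow> cls i = {h i, l i} \<and> h i \<noteq> l i \<and> x (l i) \<le> x (h i)"
    using two all2 by metis
  then obtain h l where hl: "\<And>i. i < k \<Longrightarrow> cls i = {h i, l i} \<and> h i \<noteq> l i \<and> x (l i) \<le> x (h i)"
    by blast
  \<comment> \<open>All classes being pairs, the bound of 8 vertices becomes a bound on the number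
    of colours.\<close>
  have "(\<Sum>i<k. card (cls i)) = 2 * k" using all2 by simp
  hence k4: "k \<le> 4" using small by simp
  have adj: "adj (h a) (h b) \<and> adj (h a) (l b) \<and> \<not> adj (l a) (l b)" if "a < k" "b < k" "a \<noteq> b" for a b
  proof -
    have c: "cls a = {h a, l a}" "cls b = {h b, l b}" using hl that by blast+
    have d: "h a \<noteq> l a" "h b \<noteq> l b" and le: "x (l a) \<le> x (h a)" "x (l b) \<le> x (h b)"
      using hl that by blast+
    have p: "x (h a) > 0" "x (l a) > 0" "x (h b) > 0" "x (l b) > 0"
      using pos[of a] pos[of b] that c by simp_all
    have r: "weight_regular adj x t {h a, l a} {h b, l b}" "weight_regular adj x t {h b, l b} {h a, l a}"
      using reg[of a b] reg[of b a] that c by simp_all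
    show ?thesis
      using two_by_two_classes(2,3,5)[where adj = adj, OF t sym d p r le] by (intro conjI)
  qed
  have "\<forall>i<k. cls i = {h i, l i} \<and> h i \<noteq> l i" using hl by blast
  moreover have "\<forall>a<k. \<forall>b<k. a \<noteq> b \<longrightarrow> adj (h a) (h b) \<and> adj (h a) (l b) \<and> \<not> adj (l a) (l b)"
    using adj by blast
  ultimately show ?thesis using g k4 by (intro exI[of _ h] exI[of _ l] conjI)
qed

section \<open>Representations in the root system E8\<close>

text \<open>Gaussian elimination: the last equation removes one unknown, so the surplus of unknowns
  over equations persists in the induction.\<close>

lemma homogeneous_system_nontrivial:
  fixes a :: "nat \<Rightarrow> 'a \<Rightarrow> real"
  assumes "finite S" "m < card S"
  shows "\<exists>x. (\<exists>s\<in>S. x s \<noteq> 0) \<and> (\<forall>i<m. (\<Sum>s\<in>S. x s * a i s) = 0)"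
  using assms
proof (induction m arbitrary: S a)
  case 0
  hence "S \<noteq> {}" by auto
  thus ?case by (intro exI[of _ "\<lambda>_. 1"]) auto
next
  case (Suc m)
  show ?case
  proof (cases "\<forall>s\<in>S. a m s = 0")
    case True
    obtain x where "\<exists>s\<in>S. x s \<noteq> 0" "\<forall>i<m. (\<Sum>s\<in>S. x s * a i s) = 0"
      using Suc.IH[of S a] Suc.prems by auto
    thus ?thesis using True by (intro exI[of _ x]) (auto simp: less_Suc_eq)
  next
    case False
    then obtain p where p: "p \<in> S" "a m p \<noteq> 0" by blast
    let ?T = "S - {p}"
    \<comment> \<open>The coefficients left after solving equation \<open>m\<close> for the unknown
      at \<open>p\<close> and substituting.\<close>
    define b where "b i s = a i s - a i p * a m s / a m p" for i s
    have "m < card ?T" using Suc.prems p by simp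
    then obtain y where y: "\<exists>s\<in>?T. y s \<noteq> 0" "\<forall>i<m. (\<Sum>s\<in>?T. y s * b i s) = 0"
      using Suc.IH[of ?T b] Suc.prems by auto
    define x where "x s = (if s = p then - (\<Sum>r\<in>?T. y r * a m r) / a m p else y s)" for s
    have split: "(\<Sum>s\<in>S. x s * a i s) = (\<Sum>s\<in>?T. y s * a i s) - (\<Sum>r\<in>?T. y r * a m r) * a i p / a m p" for i
    proof -
      have "(\<Sum>s\<in>S. x s * a i s) = x p * a i p + (\<Sum>s\<in>?T. x s * a i s)"
        using Suc.prems p by (simp add: sum.remove)
      also have "(\<Sum>s\<in>?T. x s * a i s) = (\<Sum>s\<in>?T. y s * a i s)"
        by (intro sum.cong) (auto simp: x_def)
      finally show ?thesis by (simp add: x_def)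
    qed
    have "(\<Sum>s\<in>S. x s * a i s) = 0" if "i < Suc m" for i
    proof (cases "i = m")
      case True
      thus ?thesis using p by (simp add: split)
    next
      case False
      have "(\<Sum>s\<in>?T. y s * b i s) = (\<Sum>s\<in>?T. y s * a i s - y s * a m s * (a i p / a m p))"
        by (intro sum.cong) (auto simp: b_def algebra_simps)
      also have "\<dots> = (\<Sum>s\<in>S. x s * a i s)"
        unfolding split sum_subtractf sum_distrib_right[symmetric] by simp
      finally show ?thesis using y(2) that False by simp
    qed
    moreover have "\<exists>s\<in>S. x s \<noteq> 0" using y(1) by (auto simp: x_def)
    ultimately show ?thesis by blast
  qed
qed

lemma E8_root_norm:
  assumes "x \<in> E8_roots"
  shows "x \<bullet> x = 8"
proof -
  have d: "dim_vec x = 8" using assms by (auto simp: E8_roots_def)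
  have s: "x \<bullet> x = (\<Sum>k<8. (vec_index x k)^2)"
    by (simp add: scalar_prod_def d lessThan_atLeast0 power2_eq_square)
  from assms consider (two) i j where "i < 8" "j < 8" "i \<noteq> j" "vec_index x i \<in> {2, -2}" "vec_index x j \<in> {2, -2}"
      "\<forall>k<8. k \<noteq> i \<longrightarrow> k \<noteq> j \<longrightarrow> vec_index x k = 0"
    | (full) "\<forall>k<8. vec_index x k \<in> {1, -1}"
    unfolding E8_roots_def by blast
  thus ?thesis
  proof cases
    case two
    have "(\<Sum>k<8. (vec_index x k)^2) = (\<Sum>k\<in>{i, j}. (vec_index x k)^2)"
      using two by (intro sum.mono_neutral_right) auto
    thus ?thesis using two by (auto simp: s)
  next
    case full
    have "(\<Sum>k<8. (vec_index x k)^2) = (\<Sum>k<(8::nat). 1)"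
      using full by (intro sum.cong) auto
    thus ?thesis by (simp add: s)
  qed
qed

text \<open>The Gram matrix of the roots is 8 times the identity plus 4 times the adjacency matrix.
  More than 8 vectors in dimension 8 are dependent, and a dependency would have Rayleigh quotient
  -2.\<close>

lemma E8_representable_card_le:
  assumes fin: "finite (pverts G)" and ne: "pverts G \<noteq> {}" and sym: "sym (parcs G)"
    and loopfree: "\<And>v. (v, v) \<notin> parcs G"
    and rep: "E8_representable G" and lmin: "lambda_min G > -2"
  shows "card (pverts G) \<le> 8"
proof (rule ccontr)
  let ?V = "pverts G"
  assume "\<not> card ?V \<le> 8"
  obtain f where f: "f ` ?V \<subseteq> E8_roots"
    "\<And>u v. u \<in> ?V \<Longrightarrow> v \<in> ?V \<Longrightarrow> u \<noteq> v \<Longrightarrow> f u \<bullet> f v = (if (u, v) \<in> parcs G then 4 else 0)"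
    using rep unfolding E8_representable_def by blast
  define g where "g i v = real_of_int (vec_index (f v) i)" for i v
  have d: "dim_vec (f v) = 8" if "v \<in> ?V" for v
    using f(1) that by (force simp: E8_roots_def)
  have gram: "(\<Sum>i<8. g i u * g i v) = (if u = v then 8 else 0) + 4 * of_bool ((u, v) \<in> parcs G)"
    if "u \<in> ?V" "v \<in> ?V" for u v
  proof -
    have "(\<Sum>i<8. g i u * g i v) = real_of_int (f u \<bullet> f v)"
      using that by (simp add: g_def scalar_prod_def d lessThan_atLeast0)
    thus ?thesis using f that E8_root_norm[of "f u"] loopfree by auto
  qed
  obtain x where x: "\<exists>v\<in>?V. x v \<noteq> 0" "\<forall>i<8. (\<Sum>v\<in>?V. x v * g i v) = 0"
    using homogeneous_system_nontrivial[OF fin, of 8 g] \<open>\<not> card ?V \<le> 8\<close> by auto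
  have "0 = (\<Sum>i<8. (\<Sum>v\<in>?V. x v * g i v)^2)" using x by simp
  also have "\<dots> = (\<Sum>i<8. \<Sum>u\<in>?V. \<Sum>v\<in>?V. (x u * x v) * (g i u * g i v))"
    by (simp add: power2_eq_square sum_product mult_ac)
  also have "\<dots> = (\<Sum>u\<in>?V. \<Sum>v\<in>?V. \<Sum>i<8. (x u * x v) * (g i u * g i v))"
    by (subst sum.swap, intro sum.cong refl, rule sum.swap)
  also have "\<dots> = (\<Sum>u\<in>?V. \<Sum>v\<in>?V. (x u * x v) * ((if u = v then 8 else 0) + 4 * of_bool ((u, v) \<in> parcs G)))"
    unfolding sum_distrib_left[symmetric] by (intro sum.cong refl) (simp add: gram)
  also have "\<dots> = (\<Sum>u\<in>?V. \<Sum>v\<in>?V. (if u = v then 8 * (x v)^2 else 0) + 4 * (of_bool ((u, v) \<in> parcs G) * x u * x v))"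
    by (intro sum.cong refl) (auto simp: power2_eq_square)
  also have "\<dots> = 8 * (\<Sum>v\<in>?V. (x v)^2) + 4 * adj_form G x"
    using fin by (simp add: sum.distrib adj_form_def sum_distrib_left)
  finally have "adj_form G x = - 2 * (\<Sum>v\<in>?V. (x v)^2)" by simp
  moreover have "lambda_min G * (\<Sum>v\<in>?V. (x v)^2) > - 2 * (\<Sum>v\<in>?V. (x v)^2)"
    using lmin sum_squares_pos[OF fin x(1)] by (intro mult_strict_right_mono)
  ultimately show False using rayleigh_lambda_min[OF fin ne sym, of x] by simp
qed

section \<open>Equality in the Hoffman bound\<close>

text \<open>Library connectedness refers to the symmetric closure of the arcs, which adds nothing
  when \<open>parcs G\<close> is symmetric; induction along a walk then stays in
  \<open>S\<close>.\<close>

lemma connected_closed_set: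
  assumes conn: "Digraph_Component.connected (with_proj G)" and sym: "sym (parcs G)"
    and S: "S \<subseteq> pverts G" "S \<noteq> {}" and closed: "\<And>u v. u \<in> S \<Longrightarrow> (u, v) \<in> parcs G \<Longrightarrow> v \<in> S"
  shows "S = pverts G"
proof -
  obtain s where s: "s \<in> S" using S by blast
  have "v \<in> S" if "v \<in> pverts G" for v
  proof -
    have "s \<rightarrow>\<^sup>*\<^bsub>with_proj (mk_symmetric (with_proj G))\<^esub> v"
      using conn s S that unfolding connected_def strongly_connected_def
      by (auto simp: mk_symmetric_def)
    thus ?thesis unfolding reachable_def
    proof (induction rule: rtrancl_on_induct)
      case base
      show ?case using s .
    next
      case (step x y)
      hence "(x, y) \<in> parcs G"
        using sym by (auto simp: mk_symmetric_def dest: symD)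
      thus ?case using closed step by blast
    qed
  qed
  thus ?thesis using S by blast
qed

text \<open>Absolute values do not decrease the form, so they turn a maximiser into a nonnegative
  one, again an eigenvector. Its support is closed under adjacency, hence everything.\<close>

lemma perron_vector:
  assumes fin: "finite (pverts G)" and ne: "pverts G \<noteq> {}" and sym: "sym (parcs G)"
    and wf: "parcs G \<subseteq> pverts G \<times> pverts G"
    and conn: "Digraph_Component.connected (with_proj G)"
  obtains x where "\<And>v. v \<in> pverts G \<Longrightarrow> x v > 0"
    "\<And>u. u \<in> pverts G \<Longrightarrow> (\<Sum>v\<in>pverts G. of_bool ((u, v) \<in> parcs G) * x v) = lambda_max G * x u"
proof -
  let ?V = "pverts G" and ?m = "\<lambda>u v. - of_bool ((u, v) \<in> parcs G) :: real"
  obtain y where y: "\<exists>v\<in>?V. y v \<noteq> 0" "adj_form G y = lambda_max G * (\<Sum>v\<in>?V. (y v)^2)"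
    using rayleigh_lambda_max(2)[OF fin ne sym] by blast
  define x where "x v = \<bar>y v\<bar>" for v
  have mf: "(\<Sum>u\<in>?V. \<Sum>v\<in>?V. ?m u v * z u * z v) = - adj_form G z" for z
    by (simp add: adj_form_def sum_negf)
  have "adj_form G y \<le> adj_form G x"
    unfolding adj_form_def
    by (intro sum_mono) (auto simp: x_def of_bool_def abs_mult[symmetric])
  moreover have "(\<Sum>v\<in>?V. (x v)^2) = (\<Sum>v\<in>?V. (y v)^2)" by (simp add: x_def)
  ultimately have x: "adj_form G x = lambda_max G * (\<Sum>v\<in>?V. (x v)^2)"
    using rayleigh_lambda_max(1)[OF fin ne sym, of x] y(2) by simp
  have ev: "(\<Sum>v\<in>?V. of_bool ((u, v) \<in> parcs G) * x v) = lambda_max G * x u" if "u \<in> ?V" for u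
  proof -
    have "(\<Sum>v\<in>?V. ?m u v * x v) = - lambda_max G * x u"
    proof (rule rayleigh_extremal_eigenvector[OF fin _ _ _ that])
      show "?m u v = ?m v u" for u v using sym by (auto dest: symD)
      show "- lambda_max G * (\<Sum>v\<in>?V. (z v)^2) \<le> (\<Sum>u\<in>?V. \<Sum>v\<in>?V. ?m u v * z u * z v)" for z
        unfolding mf using rayleigh_lambda_max(1)[OF fin ne sym, of z] by simp
      show "(\<Sum>u\<in>?V. \<Sum>v\<in>?V. ?m u v * x u * x v) = - lambda_max G * (\<Sum>v\<in>?V. (x v)^2)"
        unfolding mf using x by simp
    qed
    thus ?thesis by (simp add: sum_negf)
  qed
  have "{v\<in>?V. x v > 0} = ?V"
  proof (rule connected_closed_set[OF conn sym])
    show "{v\<in>?V. x v > 0} \<noteq> {}" using y(1) by (auto simp: x_def)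
    fix u v assume u: "u \<in> {v\<in>?V. x v > 0}" and uv: "(u, v) \<in> parcs G"
    have v: "v \<in> ?V" using uv wf by blast
    \<comment> \<open>The eigenvector equation at \<open>v\<close> includes the positive term
      \<open>x u\<close>, so \<open>x v\<close> cannot vanish.\<close>
    have "x u \<le> (\<Sum>w\<in>?V. of_bool ((v, w) \<in> parcs G) * x w)"
      using member_le_sum[of u ?V "\<lambda>w. of_bool ((v, w) \<in> parcs G) * x w"] u uv sym fin
      by (auto simp: x_def dest: symD)
    hence "0 < lambda_max G * x v" using ev[OF v] u by simp
    hence "x v \<noteq> 0" by auto
    thus "v \<in> {v\<in>?V. x v > 0}" using v by (simp add: x_def)
  qed auto
  hence "x v > 0" if "v \<in> ?V" for v using that by blast
  thus thesis using ev that by blast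
qed

text \<open>
  The \<open>k\<close> test vectors that scale \<open>x\<close> by \<open>k - 1\<close> on one colour class and by \<open>-1\<close> elsewhere
  have Rayleigh defects summing to \<open>0\<close>, so each of them lies in the eigenspace of the smallest eigenvalue.
\<close>

lemma hoffman_equality_weights:
  assumes fin: "finite (pverts G)" and ne: "pverts G \<noteq> {}" and sym: "sym (parcs G)"
    and col: "proper_coloring G k c"
    and eq: "lambda_max G = - (real k - 1) * lambda_min G"
    and x: "\<And>u. u \<in> pverts G \<Longrightarrow> (\<Sum>v\<in>pverts G. of_bool ((u, v) \<in> parcs G) * x v) = lambda_max G * x u"
    and i: "i < k" and v: "v \<in> pverts G" "c v \<noteq> i"
  shows "(\<Sum>w\<in>{w\<in>pverts G. c w = i}. of_bool ((v, w) \<in> parcs G) * x w) = - lambda_min G * x v"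
proof -
  let ?V = "pverts G" and ?A = "\<lambda>u v. of_bool ((u, v) \<in> parcs G) :: real"
  define N where "N = (\<Sum>v\<in>?V. (x v)^2)"
  define y where "y j v = (real k * of_bool (c v = j) - 1) * x v" for j v
  have ck: "c v < k" if "v \<in> ?V" for v using col that by (auto simp: proper_coloring_def)
  have cne: "c u \<noteq> c v" if "(u, v) \<in> parcs G" for u v using col that by (auto simp: proper_coloring_def)
  \<comment> \<open>Summed over all colours, the products of test vectors depend only on whether the
    two colours agree. On arcs they differ, which leaves the factor \<open>- k\<close>.\<close>
  have yy: "(\<Sum>j<k. y j u * y j v) = ((real k)^2 * of_bool (c u = c v) - real k) * (x u * x v)"
    if "u \<in> ?V" "v \<in> ?V" for u v
  proof -
    have "(\<Sum>j<k. y j u * y j v) = (\<Sum>j<k. ((if j = c u then (real k)^2 * of_bool (c u = c v) else 0)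
        - (if j = c u then real k else 0) - (if j = c v then real k else 0) + 1) * (x u * x v))"
      by (intro sum.cong refl) (auto simp: y_def algebra_simps power2_eq_square)
    also have "\<dots> = ((real k)^2 * of_bool (c u = c v) - real k - real k + real k) * (x u * x v)"
      unfolding sum_distrib_right[symmetric] sum.distrib sum_subtractf
      using ck[OF that(1)] ck[OF that(2)] by simp
    finally show ?thesis by simp
  qed
  have "(\<Sum>j<k. adj_form G (y j)) = (\<Sum>u\<in>?V. \<Sum>v\<in>?V. \<Sum>j<k. ?A u v * (y j u * y j v))"
    unfolding adj_form_def by (subst sum.swap, intro sum.cong refl, subst sum.swap) (simp add: mult_ac)
  also have "\<dots> = (\<Sum>u\<in>?V. \<Sum>v\<in>?V. ?A u v * (\<Sum>j<k. y j u * y j v))"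
    by (simp only: sum_distrib_left)
  also have "\<dots> = (\<Sum>u\<in>?V. \<Sum>v\<in>?V. - real k * (?A u v * x u * x v))"
    by (intro sum.cong refl) (auto simp: yy cne)
  also have "\<dots> = - real k * (lambda_max G * N)"
    unfolding sum_distrib_left[symmetric] adj_form_def[symmetric] N_def
    using adj_form_eigenvector[of G x, OF x] by simp
  finally have S1: "(\<Sum>j<k. adj_form G (y j)) = - real k * (lambda_max G * N)" .
  have "(\<Sum>j<k. \<Sum>v\<in>?V. (y j v)^2) = (\<Sum>v\<in>?V. \<Sum>j<k. y j v * y j v)"
    by (subst sum.swap) (simp add: power2_eq_square)
  also have "\<dots> = (\<Sum>v\<in>?V. ((real k)^2 - real k) * (x v)^2)"
    by (intro sum.cong refl) (auto simp: yy power2_eq_square)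
  finally have S2: "(\<Sum>j<k. \<Sum>v\<in>?V. (y j v)^2) = ((real k)^2 - real k) * N"
    by (simp add: N_def sum_distrib_left)
  have ge: "0 \<le> adj_form G (y j) - lambda_min G * (\<Sum>v\<in>?V. (y j v)^2)" for j
    using rayleigh_lambda_min[OF fin ne sym, of "y j"] by simp
  have "(\<Sum>j<k. adj_form G (y j) - lambda_min G * (\<Sum>v\<in>?V. (y j v)^2))
      = - real k * (lambda_max G * N) - lambda_min G * (((real k)^2 - real k) * N)"
    by (simp only: sum_subtractf sum_distrib_left[symmetric] S1 S2)
  also have "\<dots> = 0" unfolding eq by (simp add: algebra_simps power2_eq_square)
  finally have "\<forall>j\<in>{..<k}. adj_form G (y j) - lambda_min G * (\<Sum>v\<in>?V. (y j v)^2) = 0"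
    using ge by (subst (asm) sum_nonneg_eq_0_iff) auto
  hence yi: "adj_form G (y i) = lambda_min G * (\<Sum>v\<in>?V. (y i v)^2)" using i by simp
  have "(\<Sum>w\<in>?V. ?A v w * y i w) = lambda_min G * y i v"
  proof (rule rayleigh_extremal_eigenvector[OF fin _ _ _ v(1)])
    show "?A u v = ?A v u" for u v using sym by (auto dest: symD)
    show "lambda_min G * (\<Sum>v\<in>?V. (z v)^2) \<le> (\<Sum>u\<in>?V. \<Sum>v\<in>?V. ?A u v * z u * z v)" for z
      using rayleigh_lambda_min[OF fin ne sym, of z] by (simp add: adj_form_def)
    show "(\<Sum>u\<in>?V. \<Sum>v\<in>?V. ?A u v * y i u * y i v) = lambda_min G * (\<Sum>v\<in>?V. (y i v)^2)"
      using yi by (simp add: adj_form_def)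
  qed
  also have "y i v = - x v" using v by (simp add: y_def)
  \<comment> \<open>The sum splits into \<open>k\<close> times the weight seen in class
    \<open>i\<close>, minus the total weight seen, which the eigenvector equation evaluates.\<close>
  also have "(\<Sum>w\<in>?V. ?A v w * y i w) = (\<Sum>w\<in>?V. real k * (if c w = i then ?A v w * x w else 0) - ?A v w * x w)"
    by (intro sum.cong refl) (auto simp: y_def algebra_simps)
  also have "\<dots> = real k * (\<Sum>w\<in>{w\<in>?V. c w = i}. ?A v w * x w) - lambda_max G * x v"
    unfolding sum_subtractf x[OF v(1)] sum_distrib_left[symmetric]
    by (simp only: sum.inter_filter[OF fin])
  finally have "real k * (\<Sum>w\<in>{w\<in>?V. c w = i}. ?A v w * x w) = real k * (- lambda_min G * x v)"
    unfolding eq by (simp add: algebra_simps)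
  moreover have "real k \<noteq> 0" using i by simp
  ultimately show ?thesis using mult_left_cancel[THEN iffD1] by blast
qed

section \<open>Test vectors of small support, and colourings\<close>

lemma adj_form_support:
  assumes "finite (pverts G)" "S \<subseteq> pverts G" "\<And>v. v \<notin> S \<Longrightarrow> x v = 0"
  shows "adj_form G x = (\<Sum>u\<in>S. \<Sum>v\<in>S. of_bool ((u, v) \<in> parcs G) * x u * x v)"
    and "(\<Sum>v\<in>pverts G. (x v)^2) = (\<Sum>v\<in>S. (x v)^2)"
proof -
  show "(\<Sum>v\<in>pverts G. (x v)^2) = (\<Sum>v\<in>S. (x v)^2)"
    using assms by (intro sum.mono_neutral_right) auto
  have "adj_form G x = (\<Sum>u\<in>S. \<Sum>v\<in>pverts G. of_bool ((u, v) \<in> parcs G) * x u * x v)"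
    unfolding adj_form_def using assms by (intro sum.mono_neutral_right) auto
  also have "\<dots> = (\<Sum>u\<in>S. \<Sum>v\<in>S. of_bool ((u, v) \<in> parcs G) * x u * x v)"
    using assms by (intro sum.cong refl sum.mono_neutral_right) auto
  finally show "adj_form G x = (\<Sum>u\<in>S. \<Sum>v\<in>S. of_bool ((u, v) \<in> parcs G) * x u * x v)" .
qed

text \<open>The values 1 and -1 at the ends of an edge give Rayleigh quotient -1.\<close>

lemma lambda_min_neg:
  assumes fin: "finite (pverts G)" and sym: "sym (parcs G)" and wf: "parcs G \<subseteq> pverts G \<times> pverts G"
    and loopfree: "\<And>v. (v, v) \<notin> parcs G" and e: "(u, w) \<in> parcs G"
  shows "lambda_min G < 0"
proof -
  define x where "x v = (if v = u then 1 else if v = w then -1 else 0 :: real)" for v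
  have d: "u \<noteq> w" "u \<in> pverts G" "w \<in> pverts G" "(w, u) \<in> parcs G"
    using e wf loopfree sym by (auto dest: symD)
  have "x v = 0" if "v \<notin> {u, w}" for v using that by (simp add: x_def)
  note s = adj_form_support[where x = x and S = "{u, w}", OF fin _ this]
  have "adj_form G x = - 2" "(\<Sum>v\<in>pverts G. (x v)^2) = 2"
    using s d e loopfree by (auto simp: x_def)
  moreover have "pverts G \<noteq> {}" using d by blast
  ultimately show ?thesis using rayleigh_lambda_min[OF fin _ sym, of x] by simp
qed

text \<open>An induced path on three vertices, weighted 1, -1, 1, has Rayleigh quotient -4/3.
  Without such paths the closed neighbourhood of \<open>u\<close> is closed under adjacency, hence
  everything.\<close>

lemma lambda_min_minus_one_complete:
  assumes fin: "finite (pverts G)" and sym: "sym (parcs G)" and wf: "parcs G \<subseteq> pverts G \<times> pverts G"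
    and loopfree: "\<And>v. (v, v) \<notin> parcs G"
    and conn: "Digraph_Component.connected (with_proj G)" and l: "lambda_min G = -1"
    and uw: "u \<in> pverts G" "w \<in> pverts G" "u \<noteq> w"
  shows "(u, w) \<in> parcs G"
proof -
  let ?S = "{v\<in>pverts G. v = u \<or> (u, v) \<in> parcs G}"
  have "?S = pverts G"
  proof (rule connected_closed_set[OF conn sym])
    fix a b assume a: "a \<in> ?S" and ab: "(a, b) \<in> parcs G"
    have b: "b \<in> pverts G" using ab wf by blast
    show "b \<in> ?S"
    proof (rule ccontr)
      assume "b \<notin> ?S"
      hence n: "b \<noteq> u" "(u, b) \<notin> parcs G" "(b, u) \<notin> parcs G" using b sym by (auto dest: symD)
      hence ua: "(u, a) \<in> parcs G" "(a, u) \<in> parcs G" "(b, a) \<in> parcs G" "a \<noteq> u" "a \<noteq> b"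
        using a ab sym loopfree by (auto dest: symD)
      define x where "x v = (if v = a then -1 else if v = u \<or> v = b then 1 else 0 :: real)" for v
      have "x v = 0" if "v \<notin> {u, a, b}" for v using that by (simp add: x_def)
      note s = adj_form_support[where x = x and S = "{u, a, b}", OF fin _ this]
      have "adj_form G x = - 4" "(\<Sum>v\<in>pverts G. (x v)^2) = 3"
        using s a b n ua ab uw loopfree by (auto simp: x_def)
      thus False using rayleigh_lambda_min[OF fin _ sym, of x] b l by auto
    qed
  qed (use uw in auto)
  hence "w \<in> ?S" by (simp only: uw(2))
  thus ?thesis using uw(3) by simp
qed

lemma complete_imp_balanced_complete_multipartite:
  assumes "\<And>v. (v, v) \<notin> parcs G"
    and "\<And>u w. u \<in> pverts G \<Longrightarrow> w \<in> pverts G \<Longrightarrow> u \<noteq> w \<Longrightarrow> (u, w) \<in> parcs G"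
  shows "balanced_complete_multipartite G"
  unfolding balanced_complete_multipartite_def
  using assms
  by (intro exI[of _ 1] exI[of _ "(\<lambda>v. {v}) ` pverts G"])
     (auto simp: partition_on_def disjoint_def)

text \<open>Numbering the vertices is a proper colouring, so the \<open>LEAST\<close> in
  \<open>chromatic_number\<close> is attained.\<close>

lemma chromatic_number_coloring:
  assumes fin: "finite (pverts G)" and wf: "parcs G \<subseteq> pverts G \<times> pverts G"
    and loopfree: "\<And>v. (v, v) \<notin> parcs G"
  shows "\<exists>c. proper_coloring G (chromatic_number G) c"
proof -
  obtain f where "bij_betw f (pverts G) {0..<card (pverts G)}"
    using ex_bij_betw_finite_nat[OF fin] by blast
  hence "proper_coloring G (card (pverts G)) f"
    using wf loopfree unfolding proper_coloring_def bij_betw_def inj_on_def by fastforce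
  hence "\<exists>c. proper_coloring G (card (pverts G)) c" by blast
  thus ?thesis unfolding chromatic_number_def by (rule LeastI)
qed

lemma bipartite_if_two_colors:
  assumes wf: "parcs G \<subseteq> pverts G \<times> pverts G" and col: "proper_coloring G k c" and k: "k \<le> 2"
  shows "bipartite G"
  unfolding bipartite_def
proof (intro exI conjI)
  let ?U = "{v\<in>pverts G. c v = 0}" and ?W = "{v\<in>pverts G. c v \<noteq> 0}"
  show "pverts G = ?U \<union> ?W" "?U \<inter> ?W = {}" by auto
  show "parcs G \<subseteq> ?U \<times> ?W \<union> ?W \<times> ?U"
  proof (clarify)
    fix u v assume uv: "(u, v) \<in> parcs G" "\<not> (u \<in> ?W \<and> v \<in> ?U)"
    hence m: "u \<in> pverts G" "v \<in> pverts G" using wf by auto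
    hence "c u < 2" "c v < 2" "c u \<noteq> c v" using col uv k by (auto simp: proper_coloring_def)
    thus "u \<in> ?U \<and> v \<in> ?W" using uv m by auto
  qed
qed

text \<open>A test vector has Rayleigh quotient -36/20 = -9/5, below minus the golden ratio.\<close>

lemma no_four_class_golden_coloring:
  assumes fin: "finite (pverts G)" and sym: "sym (parcs G)"
    and col: "proper_coloring G 4 c" and gold: "(lambda_min G)^2 = - lambda_min G + 1" "lambda_min G < 0"
    and cls: "\<And>i. i < 4 \<Longrightarrow> {v \<in> pverts G. c v = i} = {h i, l i} \<and> h i \<noteq> l i"
    and adj: "\<And>i j. i < 4 \<Longrightarrow> j < 4 \<Longrightarrow> i \<noteq> j \<Longrightarrow>
      (h i, h j) \<in> parcs G \<and> (h i, l j) \<in> parcs G \<and> (l i, l j) \<notin> parcs G"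
  shows False
proof -
  have color: "h i \<in> pverts G" "l i \<in> pverts G" "c (h i) = i" "c (l i) = i" if "i < 4" for i
    using cls[OF that] by blast+
  have ck: "c v < 4" if "v \<in> pverts G" for v using col that by (auto simp: proper_coloring_def)
  have same: "(u, v) \<notin> parcs G" if "c u = c v" for u v
    using col that by (auto simp: proper_coloring_def)
  have sumV: "(\<Sum>v\<in>pverts G. g v) = (\<Sum>i<4. g (h i) + g (l i))" for g :: "'a \<Rightarrow> real"
  proof -
    have "(\<Sum>v\<in>pverts G. g v) = (\<Sum>v\<in>(\<Union>i<4. {v \<in> pverts G. c v = i}). g v)"
      using ck by (intro sum.cong) auto
    also have "\<dots> = (\<Sum>i<4. \<Sum>v\<in>{v \<in> pverts G. c v = i}. g v)"
      using fin by (intro sum.UNION_disjoint) auto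
    also have "\<dots> = (\<Sum>i<4. g (h i) + g (l i))"
      using cls by (intro sum.cong) auto
    finally show ?thesis .
  qed
  \<comment> \<open>Heavy vertices get 1, light ones -2. Each of the 12 ordered pairs of classes
    contributes 1 - 2 - 2 = -3, and the squared norm is 4 * 5.\<close>
  define y where "y v = (if v = h (c v) then 1 else -2 :: real)" for v
  have y: "y (h i) = 1" "y (l i) = - 2" if "i < 4" for i
    using cls[OF that] color[OF that] by (auto simp: y_def)
  have A: "(l i, h j) \<in> parcs G" if "i < 4" "j < 4" "i \<noteq> j" for i j
    using adj[of j i] that sym by (auto dest: symD)
  have "adj_form G y = (\<Sum>i<4. \<Sum>j<(4::nat). if i = j then 0 else - 3)"
    unfolding adj_form_def sumV sum.distrib[symmetric]
    by (intro sum.cong refl) (auto simp: y adj A same color)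
  also have "\<dots> = - 36" by (simp add: eval_nat_numeral)
  finally have Q: "adj_form G y = - 36" .
  have "(\<Sum>v\<in>pverts G. (y v)^2) = (\<Sum>i<(4::nat). 5)"
    unfolding sumV by (intro sum.cong refl) (auto simp: y)
  hence "(\<Sum>v\<in>pverts G. (y v)^2) = 20" by simp
  moreover have "pverts G \<noteq> {}" using color(1)[of 0] by auto
  ultimately have "lambda_min G * 20 \<le> - 36" using rayleigh_lambda_min[OF fin _ sym, of y] Q by simp
  moreover have "- lambda_min G < 81/50" using gold by (intro golden_bounds(2)) auto
  ultimately show False by simp
qed

section \<open>The 3-sun\<close>

text \<open>Arcs are pairs of vertices, so the vertex map \<open>f\<close> already determines the
  arc map.\<close>

lemma digraph_isoI:
  assumes wfG: "pair_wf_digraph G" and wfH: "parcs H \<subseteq> pverts H \<times> pverts H"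
    and bij: "bij_betw f (pverts G) (pverts H)"
    and arcs: "\<And>u v. u \<in> pverts G \<Longrightarrow> v \<in> pverts G \<Longrightarrow> (f u, f v) \<in> parcs H \<longleftrightarrow> (u, v) \<in> parcs G"
  shows "digraph_iso (with_proj G) (with_proj H)"
proof -
  interpret pair_wf_digraph G by fact
  let ?h = "\<lparr>iso_verts = f, iso_arcs = map_prod f f, iso_head = snd, iso_tail = fst\<rparr>"
  have inj: "inj_on f (pverts G)" and im: "f ` pverts G = pverts H" using bij by (auto simp: bij_betw_def)
  have wfG': "parcs G \<subseteq> pverts G \<times> pverts G" using in_arcsD1 in_arcsD2 by auto
  have "inj_on (map_prod f f) (parcs G)"
    using map_prod_inj_on[OF inj inj] wfG' by (rule inj_on_subset)
  moreover have "map_prod f f ` parcs G = parcs H"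
  proof
    show "map_prod f f ` parcs G \<subseteq> parcs H" using arcs wfG' by auto
    show "parcs H \<subseteq> map_prod f f ` parcs G"
    proof (clarify)
      fix a b assume ab: "(a, b) \<in> parcs H"
      then obtain u v where "u \<in> pverts G" "v \<in> pverts G" "a = f u" "b = f v"
        using wfH im by blast
      thus "(a, b) \<in> map_prod f f ` parcs G" using arcs ab by force
    qed
  qed
  moreover have "wf_digraph (with_proj G)" using wfG by (simp add: wf_digraph_wp_iff)
  ultimately show ?thesis
    unfolding digraph_iso_def pre_digraph.digraph_isomorphism_def app_iso_def
    using inj im by (intro exI[of _ ?h]) (auto simp: with_proj_def)
qed

text \<open>The net: a triangle on 0, 1, 2 with pendant vertices 3, 4, 5.\<close>

definition net_graph :: "nat pair_pre_digraph" where
  "net_graph = \<lparr> pverts = {..<6},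
     parcs = (let E = {(1,2), (0,2), (0,1), (0,3), (1,4), (2,5)} in E \<union> E\<inverse>) \<rparr>"

lemma pair_graph_net: "pair_graph net_graph"
  by unfold_locales (auto simp: net_graph_def symmetric_def sym_def Let_def)

lemma edge_set_net: "edge_set net_graph = {{1,2}, {0,2}, {0,1}, {0,3}, {1,4}, {2,5}}"
proof -
  have e: "edge_set \<lparr>pverts = {..<6}, parcs = E \<union> E\<inverse>\<rparr> = (\<lambda>(u, v). {u, v}) ` E" for E :: "(nat \<times> nat) set"
    unfolding edge_set_def by (force simp: insert_commute)
  show ?thesis unfolding net_graph_def Let_def e by simp
qed

text \<open>The triangle \<open>a, b, c\<close> corresponds to the triangle edges of the net, and
  \<open>a', b', c'\<close> to the pendant edges. Each triangle edge misses exactly the pendant edge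
  at the opposite corner.\<close>

lemma three_sun_generalized_line_graph:
  assumes wf: "pair_wf_digraph G" and sym: "sym (parcs G)" and loopfree: "\<And>v. (v, v) \<notin> parcs G"
    and V: "pverts G = {a, b, c, a', b', c'}" and d: "distinct [a, b, c, a', b', c']"
    and e: "(a, b) \<in> parcs G" "(a, c) \<in> parcs G" "(b, c) \<in> parcs G"
      "(a, b') \<in> parcs G" "(a, c') \<in> parcs G" "(b, a') \<in> parcs G" "(b, c') \<in> parcs G"
      "(c, a') \<in> parcs G" "(c, b') \<in> parcs G"
    and n: "(a, a') \<notin> parcs G" "(b, b') \<notin> parcs G" "(c, c') \<notin> parcs G"
      "(a', b') \<notin> parcs G" "(a', c') \<notin> parcs G" "(b', c') \<notin> parcs G"
  shows "is_generalized_line_graph G"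
proof -
  define f where "f v = (if v = a then {1,2} else if v = b then {0,2} else if v = c then {0,1}
     else if v = a' then {0,3} else if v = b' then {1,4} else {2,5::nat})" for v
  \<comment> \<open>Empty cocktail parties reduce the generalized line graph to the ordinary
    one.\<close>
  let ?H = "generalized_line_graph net_graph (\<lambda>_. 0)"
  have vH: "pverts ?H = Inl ` edge_set net_graph"
    by (auto simp: generalized_line_graph_def line_graph_def cocktail_party_def)
  have aH: "parcs ?H = {(Inl e, Inl f) | e f. e \<in> edge_set net_graph \<and> f \<in> edge_set net_graph \<and> e \<noteq> f \<and> e \<inter> f \<noteq> {}}"
    by (auto simp: generalized_line_graph_def line_graph_def cocktail_party_def)
  have fv: "f a = {1,2}" "f b = {0,2}" "f c = {0,1}" "f a' = {0,3}" "f b' = {1,4}" "f c' = {2,5}"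
    using d by (auto simp: f_def)
  have e': "(b, a) \<in> parcs G" "(c, a) \<in> parcs G" "(c, b) \<in> parcs G"
      "(b', a) \<in> parcs G" "(c', a) \<in> parcs G" "(a', b) \<in> parcs G" "(c', b) \<in> parcs G"
      "(a', c) \<in> parcs G" "(b', c) \<in> parcs G" using e sym by (auto dest: symD)
  have n': "(a', a) \<notin> parcs G" "(b', b) \<notin> parcs G" "(c', c) \<notin> parcs G"
      "(b', a') \<notin> parcs G" "(c', a') \<notin> parcs G" "(c', b') \<notin> parcs G"
    using n sym by (auto dest: symD)
  have img: "f ` pverts G = edge_set net_graph"
    unfolding V edge_set_net by (simp only: image_insert image_empty fv)
  have "digraph_iso (with_proj G) (with_proj ?H)"
  proof (rule digraph_isoI[OF wf, where f = "Inl \<circ> f"])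
    show "parcs ?H \<subseteq> pverts ?H \<times> pverts ?H" unfolding vH aH by auto
    \<comment> \<open>Injectivity follows from surjectivity onto a set of the same size.\<close>
    have "card (pverts G) = 6" using d by (simp add: V)
    moreover have "card (edge_set net_graph) = 6"
      by (simp add: edge_set_net doubleton_eq_iff)
    ultimately have "inj_on f (pverts G)"
      using img by (intro eq_card_imp_inj_on) (auto simp: V)
    thus "bij_betw (Inl \<circ> f) (pverts G) (pverts ?H)"
      unfolding vH bij_betw_def img[symmetric] by (simp add: inj_on_def image_comp)
    have "\<forall>u\<in>pverts G. \<forall>v\<in>pverts G. (f u \<noteq> f v \<and> f u \<inter> f v \<noteq> {}) \<longleftrightarrow> (u, v) \<in> parcs G"
      unfolding V by (simp add: fv e e' n n' loopfree doubleton_eq_iff)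
    thus "((Inl \<circ> f) u, (Inl \<circ> f) v) \<in> parcs ?H \<longleftrightarrow> (u, v) \<in> parcs G"
      if "u \<in> pverts G" "v \<in> pverts G" for u v
      using that imageI[OF that(1), of f] imageI[OF that(2), of f] unfolding aH img by auto
  qed
  thus ?thesis using pair_graph_net unfolding is_generalized_line_graph_def by blast
qed

section \<open>Reduction to three or four classes of size two\<close>

theorem mainTheorem5:
  shows "\<not> (\<exists>G :: 'a pair_pre_digraph. pair_graph G \<and> nontrivially_hoffman_colorable G \<and>
    exceptional G \<and> lambda_min G > -2)"
proof
  assume "\<exists>G :: 'a pair_pre_digraph. pair_graph G \<and> nontrivially_hoffman_colorable G \<and>
    exceptional G \<and> lambda_min G > -2"
  then obtain G :: "'a pair_pre_digraph" where pg: "pair_graph G"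
    and hc: "parcs G \<noteq> {}" "real (chromatic_number G) = 1 - lambda_max G / lambda_min G"
    and nb: "\<not> bipartite G" and nm: "\<not> balanced_complete_multipartite G"
    and conn: "Digraph_Component.connected (with_proj G)" and ng: "\<not> is_generalized_line_graph G"
    and rep: "E8_representable G" and lmin: "lambda_min G > -2"
    unfolding nontrivially_hoffman_colorable_def hoffman_colorable_def exceptional_def by blast
  interpret pair_graph G by fact
  let ?V = "pverts G" and ?adj = "\<lambda>u v. (u, v) \<in> parcs G"
  define k t where "k = chromatic_number G" and "t = - lambda_min G"
  have fin: "finite ?V" by (rule pair_finite_verts)
  have sym: "sym (parcs G)" using pair_sym_arcs by (simp add: symmetric_def)
  have wf: "parcs G \<subseteq> ?V \<times> ?V" using in_arcsD1 in_arcsD2 by auto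
  have loopfree: "(v, v) \<notin> parcs G" for v using pair_no_loops[of "(v, v)"] by auto
  obtain u0 w0 where uw0: "(u0, w0) \<in> parcs G" using hc(1) by auto
  hence ne: "?V \<noteq> {}" using wf by blast
  have neg: "lambda_min G < 0" using lambda_min_neg[OF fin sym wf loopfree uw0] .
  have t: "0 < t" "t < 2" using neg lmin by (auto simp: t_def)
  have eq: "lambda_max G = - (real k - 1) * lambda_min G"
    using hc(2) neg by (simp add: k_def field_simps)
  obtain c where col: "proper_coloring G k c"
    using chromatic_number_coloring[OF fin wf loopfree] by (auto simp: k_def)
  have k3: "3 \<le> k" using bipartite_if_two_colors[OF wf col] nb by linarith
  obtain x where xpos: "\<And>v. v \<in> ?V \<Longrightarrow> x v > 0"
    and xev: "\<And>u. u \<in> ?V \<Longrightarrow> (\<Sum>v\<in>?V. of_bool ((u, v) \<in> parcs G) * x v) = lambda_max G * x u"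
    using perron_vector[OF fin ne sym wf conn] by blast
  define cls where "cls i = {v\<in>?V. c v = i}" for i
  have ck: "c v < k" if "v \<in> ?V" for v using col that by (auto simp: proper_coloring_def)
  have reg: "weight_regular ?adj x t (cls i) (cls j)" if "i < k" "j < k" "i \<noteq> j" for i j
    using hoffman_equality_weights[OF fin ne sym col eq xev \<open>j < k\<close>] that
    by (auto simp: weight_regular_def cls_def t_def)
  \<comment> \<open>A vertex of another colour would see weight 0 in an empty class, whereas
    regularity demands the positive weight \<open>t * x v\<close>.\<close>
  have clsne: "cls i \<noteq> {}" if i: "i < k" for i
  proof
    assume e: "cls i = {}"
    obtain v where v: "v \<in> ?V" using ne by blast
    hence "c v \<noteq> i" using e by (auto simp: cls_def)
    hence "v \<in> cls (c v)" "c v < k" "c v \<noteq> i" using v ck by (auto simp: cls_def)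
    hence "t * x v = 0" using weight_regularD[OF reg[of "c v" i]] i e by simp
    thus False using t xpos[OF v] by simp
  qed
  have "(\<Sum>i<k. card (cls i)) = card (\<Union>i<k. cls i)"
    using fin by (intro card_UN_disjoint[symmetric]) (auto simp: cls_def)
  also have "(\<Union>i<k. cls i) = ?V" using ck by (auto simp: cls_def)
  finally have small: "(\<Sum>i<k. card (cls i)) \<le> 8"
    using E8_representable_card_le[OF fin ne sym loopfree rep lmin] by simp
  have t1: "t \<noteq> 1"
  proof
    assume "t = 1"
    hence "lambda_min G = -1" by (simp add: t_def)
    hence "balanced_complete_multipartite G"
      using lambda_min_minus_one_complete[OF fin sym wf loopfree conn]
      by (intro complete_imp_balanced_complete_multipartite loopfree)
    thus False using nm by blast
  qed
  have adj_sym: "?adj a b \<Longrightarrow> ?adj b a" for a b using sym by (auto dest: symD)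
  have cfin: "finite (cls i)" for i using fin by (simp add: cls_def)
  have cpos: "x v > 0" if "v \<in> cls i" for i v using that xpos by (simp add: cls_def)
  have "\<exists>h l. t^2 = t + 1 \<and> k \<le> 4 \<and> (\<forall>i<k. cls i = {h i, l i} \<and> h i \<noteq> l i) \<and>
    (\<forall>i<k. \<forall>j<k. i \<noteq> j \<longrightarrow> ?adj (h i) (h j) \<and> ?adj (h i) (l j) \<and> \<not> ?adj (l i) (l j))"
    by (rule small_weighted_coloring[where adj = ?adj, OF k3 small cfin clsne adj_sym cpos t t1 reg])
  then obtain h l where tt: "t^2 = t + 1" and k4: "k \<le> 4"
    and hl: "\<And>i. i < k \<Longrightarrow> cls i = {h i, l i} \<and> h i \<noteq> l i"
    and adj: "\<And>i j. i < k \<Longrightarrow> j < k \<Longrightarrow> i \<noteq> j \<Longrightarrow>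
      ?adj (h i) (h j) \<and> ?adj (h i) (l j) \<and> \<not> ?adj (l i) (l j)"
    by blast
  show False
  proof (cases "k = 4")
    case True
    show False
      by (rule no_four_class_golden_coloring[OF fin sym col[unfolded True] _ neg, of h l])
         (use True tt hl adj in \<open>auto simp: t_def cls_def\<close>)
  next
    case False
    hence k: "k = 3" using k3 k4 by simp
    have color: "h i \<in> ?V" "l i \<in> ?V" "c (h i) = i" "c (l i) = i" "h i \<noteq> l i" if "i < 3" for i
      using hl[of i] that unfolding k cls_def by blast+
    have same: "(u, v) \<notin> parcs G" if "c u = c v" for u v
      using col that by (auto simp: proper_coloring_def)
    have "?V = cls 0 \<union> cls 1 \<union> cls 2"
      using ck by (auto simp: cls_def k eval_nat_numeral less_Suc_eq)
    \<comment> \<open>The heavy vertices form the triangle of the 3-sun; \<open>l i\<close> is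
      nonadjacent to \<open>h i\<close>, which has the same colour, so it plays the part of the
      opposite outer vertex.\<close>
    hence V: "?V = {h 0, h 1, h 2, l 0, l 1, l 2}" using hl[of 0] hl[of 1] hl[of 2] k by auto
    have "distinct [c (h 0), c (h 1), c (h 2)]" by (simp add: color)
    hence d: "distinct [h 0, h 1, h 2, l 0, l 1, l 2]" using color[of 0] color[of 1] color[of 2] by auto
    have "is_generalized_line_graph G"
      by (rule three_sun_generalized_line_graph[OF pair_wf_digraph_axioms sym loopfree V d])
         (use adj k in \<open>simp_all add: same color\<close>)
    thus False using ng by blast
  qed
qed

end
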